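(* Let $X=W/\langle f\rangle$ be a classical, intermediary or generic Hopf manifold of dimension $n\ge3$ and let $\mathcal F$ be a nonsingular codimension-one holomorphic foliation on $X$. Then $\mathcal F$ has a holomorphic first integral.
   Context: Let $W=\mathbb C^n\setminus\{0\}$ and $f(z_1,\dots,z_n)=(\mu_1z_1,\dots,\mu_nz_n)$ with $0<|\mu_i|<1$ for all $i$. The compact complex manifold $X=W/\langle f\rangle$ is called a Hopf manifold. Here $\mathbb N$ includes $0$. Types of Hopf manifolds. $X$ is classical if $\mu_1=\dots=\mu_n$. $X$ is generic if $0<|\mu_1|\le\dots\le|\mu_n|<1$ and there is no non-trivial relation $\prod_{i\in A}\mu_i^{r_i}=\prod_{j\in B}\mu_j^{r_j}$ with $r_i,r_j\in\mathbb N$, $A\cap B=\emptyset$, $A\cup B=\{1,\dots,n\}$ (non-trivial: not all exponents are zero). $X$ is intermediary if $\mu_1=\dots=\mu_r$ for some $2\le r\le n-1$ and there is no non-trivial relation $\prod_{i\in A}\mu_i^{r_i}=\prod_{j\in B}\mu_j^{r_j}$ with $r_i,r_j\in\mathbb N$, $A\cap B=\emptyset$, $A\cup B=\{1,r+1,\dots,n\}$. For $b\in\mathbb C^*$, $L_b$ is the line bundle on $X$ obtained as the quotient of $W\times\mathbb C$ by $(z,v)\mapsto(f(z),bv)$; every line bundle on $X$ is of this form. A nonsingular codimension-one foliation $\mathcal F$ on $X$ is given by a nowhere vanishing section of $\Omega^1_X\otimes L_{b^{-1}}$ for some $b$ whose pullback to $W$, a nowhere vanishing holomorphic $1$-form $\omega$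 on $W$, satisfies $\omega\wedge d\omega=0$. A holomorphic first integral of $\mathcal F$ is understood on $W$: a nonconstant holomorphic function $h$ on $W$ with $\omega\wedge dh=0$. *)

theory Defs
  imports "HOL-Analysis.Analysis"
begin

text \<open>
  Complex \<open>n\<close>-space is \<open>complex ^ 'n\<close>, where the coordinates \<open>1, \<dots>, n\<close> are the elements of a finite
  linearly ordered type \<open>'n\<close>; the order is used in the definitions of generic and intermediary
  Hopf manifolds. A differential form at a point is a function of tangent vectors in \<open>complex ^ 'n\<close>.
\<close>

section \<open>Holomorphic functions and forms in several variables\<close>

text \<open>The domain \<open>S\<close> is meant to be open.\<close>

definition holomorphic_fun_on :: "((complex ^ 'n) \<Rightarrow> complex) \<Rightarrow> (complex ^ 'n) set \<Rightarrow> bool" where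
  "holomorphic_fun_on h S \<longleftrightarrow>
     (\<forall>z\<in>S. \<exists>D. Vector_Spaces.linear (*s) (*) D \<and> (h has_derivative D) (at z))"

definition holomorphic_one_form_on ::
    "((complex ^ 'n) \<Rightarrow> (complex ^ 'n) \<Rightarrow> complex) \<Rightarrow> (complex ^ 'n) set \<Rightarrow> bool" where
  "holomorphic_one_form_on \<omega> S \<longleftrightarrow>
     (\<forall>z\<in>S. Vector_Spaces.linear (*s) (*) (\<omega> z)) \<and> (\<forall>v. holomorphic_fun_on (\<lambda>z. \<omega> z v) S)"

definition d_fun :: "((complex ^ 'n) \<Rightarrow> complex) \<Rightarrow> (complex ^ 'n) \<Rightarrow> (complex ^ 'n) \<Rightarrow> complex" where
  "d_fun h z = frechet_derivative h (at z)"

definition d_one_form ::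
    "((complex ^ 'n) \<Rightarrow> (complex ^ 'n) \<Rightarrow> complex) \<Rightarrow>
     (complex ^ 'n) \<Rightarrow> (complex ^ 'n) \<Rightarrow> (complex ^ 'n) \<Rightarrow> complex" where
  "d_one_form \<omega> z u v = d_fun (\<lambda>x. \<omega> x v) z u - d_fun (\<lambda>x. \<omega> x u) z v"

definition wedge_1_1 :: "('v \<Rightarrow> complex) \<Rightarrow> ('v \<Rightarrow> complex) \<Rightarrow> 'v \<Rightarrow> 'v \<Rightarrow> complex" where
  "wedge_1_1 \<alpha> \<beta> u v = \<alpha> u * \<beta> v - \<alpha> v * \<beta> u"

definition wedge_1_2 ::
    "('v \<Rightarrow> complex) \<Rightarrow> ('v \<Rightarrow> 'v \<Rightarrow> complex) \<Rightarrow> 'v \<Rightarrow> 'v \<Rightarrow> 'v \<Rightarrow> complex" where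
  "wedge_1_2 \<alpha> \<theta> u v w = \<alpha> u * \<theta> v w + \<alpha> v * \<theta> w u + \<alpha> w * \<theta> u v"

section \<open>Hopf manifolds and their line bundles\<close>

definition W :: "(complex ^ 'n) set" where
  "W = UNIV - {0}"

definition hopf_map :: "complex ^ 'n \<Rightarrow> complex ^ 'n \<Rightarrow> complex ^ 'n" where
  "hopf_map \<mu> z = (\<chi> i. \<mu> $ i * z $ i)"

text \<open>
  For a bijection \<open>g\<close> of \<open>S\<close>, two points are related iff they lie in the same orbit of the group
  generated by \<open>g\<close>, i.e.\ one is an iterated image of the other.
\<close>

definition orbit_rel :: "'a set \<Rightarrow> ('a \<Rightarrow> 'a) \<Rightarrow> ('a \<times> 'a) set" where
  "orbit_rel S g = {(x, y). x \<in> S \<and> y \<in> S \<and> (\<exists>k. y = (g ^^ k) x \<or> x = (g ^^ k) y)}"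

abbreviation base_rel :: "complex ^ 'n \<Rightarrow> ((complex ^ 'n) \<times> (complex ^ 'n)) set" where
  "base_rel \<mu> \<equiv> orbit_rel W (hopf_map \<mu>)"

text \<open>
  The derivative of the linear map \<open>hopf_map \<mu>\<close> is \<open>hopf_map \<mu>\<close> itself, so \<open>tangent_rel \<mu>\<close> is the
  orbit relation of the differential acting on the tangent bundle of \<open>W\<close>.
\<close>

abbreviation tangent_rel ::
    "complex ^ 'n \<Rightarrow> (((complex ^ 'n) \<times> (complex ^ 'n)) \<times> ((complex ^ 'n) \<times> (complex ^ 'n))) set" where
  "tangent_rel \<mu> \<equiv> orbit_rel (W \<times> UNIV) (map_prod (hopf_map \<mu>) (hopf_map \<mu>))"

abbreviation line_rel ::
    "complex ^ 'n \<Rightarrow> complex \<Rightarrow> (((complex ^ 'n) \<times> complex) \<times> ((complex ^ 'n) \<times> complex)) set" where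
  "line_rel \<mu> b \<equiv> orbit_rel (W \<times> UNIV) (map_prod (hopf_map \<mu>) (\<lambda>v. b * v))"

definition hopf_manifold :: "complex ^ 'n \<Rightarrow> (complex ^ 'n) set set" where
  "hopf_manifold \<mu> = W // base_rel \<mu>"

definition tangent_fibre ::
    "complex ^ 'n \<Rightarrow> (complex ^ 'n) set \<Rightarrow> ((complex ^ 'n) \<times> (complex ^ 'n)) set set" where
  "tangent_fibre \<mu> p = {t \<in> (W \<times> UNIV) // tangent_rel \<mu>. fst ` t = p}"

definition line_bundle_fibre ::
    "complex ^ 'n \<Rightarrow> complex \<Rightarrow> (complex ^ 'n) set \<Rightarrow> ((complex ^ 'n) \<times> complex) set set" where
  "line_bundle_fibre \<mu> b p = {l \<in> (W \<times> UNIV) // line_rel \<mu> b. fst ` l = p}"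

text \<open>
  A section of the tensor product of the cotangent bundle of \<open>X = W / \<langle>f\<rangle>\<close> with \<open>L\<^sub>b\<close> is a one-form
  on \<open>X\<close> with values in \<open>L\<^sub>b\<close>: it assigns to each point \<open>p\<close> of \<open>X\<close> a linear map from the tangent
  space to the fibre of \<open>L\<^sub>b\<close> at \<open>p\<close>.
\<close>

type_synonym 'n twisted_form =
  "(complex ^ 'n) set \<Rightarrow> ((complex ^ 'n) \<times> (complex ^ 'n)) set \<Rightarrow> ((complex ^ 'n) \<times> complex) set"

text \<open>
  The pullback to \<open>W\<close>. The class of a point \<open>z\<close> in \<open>W\<close> and the class of \<open>(z, v)\<close> are the image of \<open>z\<close>
  in \<open>X\<close> and the image of the tangent vector \<open>v\<close> at \<open>z\<close>. As \<open>f\<close> generates a group acting freely on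
  \<open>W\<close>, every element of the fibre of \<open>L\<^sub>b\<close> over the class of \<open>z\<close> has exactly one representative
  \<open>(z, a)\<close>; this trivialises the pullback of \<open>L\<^sub>b\<close>.
\<close>

definition pullback ::
    "complex ^ 'n \<Rightarrow> complex \<Rightarrow> 'n twisted_form \<Rightarrow> (complex ^ 'n) \<Rightarrow> (complex ^ 'n) \<Rightarrow> complex" where
  "pullback \<mu> b \<sigma> z v =
     (THE a. (z, a) \<in> \<sigma> (base_rel \<mu> `` {z}) (tangent_rel \<mu> `` {(z, v)}))"

text \<open>
  The quotient map from \<open>W\<close> to \<open>X\<close> is a local biholomorphism and the vector space structures on the
  fibres come from the representatives over a point \<open>z\<close>. So a section is linear on the fibres and
  holomorphic iff its pullback is, and it vanishes nowhere iff its pullback does.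
\<close>

definition holomorphic_section :: "complex ^ 'n \<Rightarrow> complex \<Rightarrow> 'n twisted_form \<Rightarrow> bool" where
  "holomorphic_section \<mu> b \<sigma> \<longleftrightarrow>
     (\<forall>p\<in>hopf_manifold \<mu>. \<forall>t\<in>tangent_fibre \<mu> p. \<sigma> p t \<in> line_bundle_fibre \<mu> b p) \<and>
     holomorphic_one_form_on (pullback \<mu> b \<sigma>) W"

definition nowhere_vanishing_on ::
    "((complex ^ 'n) \<Rightarrow> (complex ^ 'n) \<Rightarrow> complex) \<Rightarrow> (complex ^ 'n) set \<Rightarrow> bool" where
  "nowhere_vanishing_on \<omega> S \<longleftrightarrow> (\<forall>z\<in>S. \<exists>v. \<omega> z v \<noteq> 0)"

definition integrable_form_on ::
    "((complex ^ 'n) \<Rightarrow> (complex ^ 'n) \<Rightarrow> complex) \<Rightarrow> (complex ^ 'n) set \<Rightarrow> bool" where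
  "integrable_form_on \<omega> S \<longleftrightarrow> (\<forall>z\<in>S. \<forall>u v w. wedge_1_2 (\<omega> z) (d_one_form \<omega> z) u v w = 0)"

definition nonsingular_foliation :: "complex ^ 'n \<Rightarrow> complex \<Rightarrow> 'n twisted_form \<Rightarrow> bool" where
  "nonsingular_foliation \<mu> b \<sigma> \<longleftrightarrow>
     b \<noteq> 0 \<and> holomorphic_section \<mu> (inverse b) \<sigma> \<and>
     nowhere_vanishing_on (pullback \<mu> (inverse b) \<sigma>) W \<and>
     integrable_form_on (pullback \<mu> (inverse b) \<sigma>) W"

definition holomorphic_first_integral ::
    "complex ^ 'n \<Rightarrow> complex \<Rightarrow> 'n twisted_form \<Rightarrow> ((complex ^ 'n) \<Rightarrow> complex) \<Rightarrow> bool" where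
  "holomorphic_first_integral \<mu> b \<sigma> h \<longleftrightarrow>
     holomorphic_fun_on h W \<and> \<not> h constant_on W \<and>
     (\<forall>z\<in>W. \<forall>u v. wedge_1_1 (pullback \<mu> (inverse b) \<sigma> z) (d_fun h z) u v = 0)"

section \<open>Types of Hopf manifolds\<close>

definition no_nontrivial_relation :: "complex ^ 'n \<Rightarrow> 'n set \<Rightarrow> bool" where
  "no_nontrivial_relation \<mu> I \<longleftrightarrow>
     \<not> (\<exists>A B (r :: 'n \<Rightarrow> nat). A \<inter> B = {} \<and> A \<union> B = I \<and> (\<exists>i\<in>I. r i \<noteq> 0) \<and>
          (\<Prod>i\<in>A. \<mu> $ i ^ r i) = (\<Prod>j\<in>B. \<mu> $ j ^ r j))"

definition classical_hopf :: "complex ^ 'n \<Rightarrow> bool" where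
  "classical_hopf \<mu> \<longleftrightarrow> (\<forall>i j. \<mu> $ i = \<mu> $ j)"

definition generic_hopf :: "complex ^ ('n :: {finite, linorder}) \<Rightarrow> bool" where
  "generic_hopf \<mu> \<longleftrightarrow>
     (\<forall>i. 0 < norm (\<mu> $ i) \<and> norm (\<mu> $ i) < 1) \<and>
     (\<forall>i j. i \<le> j \<longrightarrow> norm (\<mu> $ i) \<le> norm (\<mu> $ j)) \<and>
     no_nontrivial_relation \<mu> UNIV"

text \<open>
  The index \<open>k\<close> is the \<open>r\<close>-th one, so \<open>card {..k}\<close> is \<open>r\<close>, and \<open>Min UNIV\<close> is the first index.
\<close>

definition intermediary_hopf :: "complex ^ ('n :: {finite, linorder}) \<Rightarrow> bool" where
  "intermediary_hopf \<mu> \<longleftrightarrow>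
     (\<exists>k. 2 \<le> card {..k} \<and> card {..k} \<le> CARD('n) - 1 \<and>
        (\<forall>i\<le>k. \<mu> $ i = \<mu> $ Min UNIV) \<and>
        no_nontrivial_relation \<mu> (insert (Min UNIV) {k<..}))"

end

theory Submission
  imports Defs "HOL-Complex_Analysis.Conformal_Mappings"
begin

text \<open>
  Let \<open>\<omega>\<close> be the form on \<open>W\<close> to which the section pulls back. It satisfies
  \<open>f\<^sup>* \<omega> = c \<omega>\<close> for a constant \<open>c\<close>, and its coefficients extend to entire functions by Hartogs, as
  \<open>n \<ge> 2\<close>. Everything reduces to showing that the extension \<open>\<Omega>\<close> is closed: the Poincare lemma on
  \<open>\<complex>\<^sup>n\<close> then gives \<open>h\<close> with \<open>dh = \<Omega>\<close>, and \<open>h\<close> is not constant because \<open>\<Omega>\<close> does not vanish.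

  In the classical case \<open>f\<close> is multiplication by a number \<open>m\<close>
  (lemma \<open>form_closed_if_homothety_equivariant\<close>). If \<open>\<Omega>\<^sub>z(u) = 0\<close>, integrability says that the
  functional \<open>d\<Omega>\<^sub>z(u, \<cdot>)\<close> is a multiple \<open>\<phi>(z, u) \<Omega>\<^sub>z\<close>, because \<open>\<Omega>\<^sub>z \<noteq> 0\<close>. The function \<open>\<phi>\<close> is
  holomorphic on the space of such pairs, linear in \<open>u\<close>, and satisfies \<open>\<phi>(m z, u) = \<phi>(z, u) / m\<close>.
  So \<open>\<bar>\<phi>(z, u)\<bar> \<bar>z\<bar> / \<bar>u\<bar>\<close> is a function on a compact space and attains its maximum, say at
  \<open>(z0, u0)\<close>. Since \<open>n \<ge> 3\<close> there is a vector \<open>a \<noteq> 0\<close> that is orthogonal to \<open>z0\<close> and along which the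
  derivative of \<open>z \<mapsto> \<Omega>\<^sub>z(u0)\<close> vanishes. On the disc \<open>z0 + s a\<close> the vector \<open>u0\<close> can be corrected to a kernel
  vector that differs from \<open>u0\<close> by \<open>o(s)\<close>, which changes the logarithm of its length by a harmonic
  function up to \<open>o(\<bar>s\<bar>\<^sup>2)\<close>, whereas \<open>\<bar>z\<bar>\<^sup>2\<close> grows by exactly \<open>\<bar>s\<bar>\<^sup>2 \<bar>a\<bar>\<^sup>2\<close>. By the maximum modulus
  principle this is impossible at a maximum, unless \<open>\<phi> = 0\<close> (lemma \<open>no_nonzero_interior_maximum\<close>).
  And \<open>\<phi> = 0\<close> means \<open>d\<Omega> = 0\<close>.

  In the other two cases (lemma \<open>nonresonant_equivariant_form_closed\<close>) the coefficients of \<open>\<Omega>\<close>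
  and their partial derivatives are eigenfunctions of composition with \<open>f\<close>, and the eigenvalue of
  a nonzero entire eigenfunction is a monomial in the multipliers \<open>\<mu>\<^sub>i\<close> (lemma
  \<open>eigenvalue_is_monomial\<close>). As the distinct multipliers are independent, \<open>c\<close> determines the
  total degree \<open>N\<close> of such a monomial, where \<open>dz\<^sub>i\<close> counts as degree one. If \<open>N = 1\<close>, the coefficients are
  constant. If \<open>N \<ge> 2\<close>, the nonvanishing of \<open>\<Omega>\<close> on the \<open>k\<close>-th axis yields \<open>c = \<mu>\<^sub>i \<mu>\<^sub>k\<^sup>N\<^sup>-\<^sup>1\<close>
  for some \<open>i\<close>. This allows at most two distinct multipliers, hence \<open>c\<close> is their product, and
  \<open>\<Omega>\<close> has linear coefficients and a zero in \<open>W\<close>, a contradiction.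
\<close>

section \<open>Holomorphic functions of several variables\<close>

text \<open>
  Contour integrals over circles become integrals over the unit interval, to which differentiation
  under the integral sign applies. Since \<open>d\<zeta> = 2 \<pi> \<i> \<zeta> dt\<close> on the circle, the factor \<open>2 \<pi> \<i>\<close> cancels.
\<close>

definition circ :: "real \<Rightarrow> real \<Rightarrow> complex" where
  "circ r t = of_real r * exp (2 * of_real pi * \<i> * of_real t)"

lemma norm_circ: "0 < r \<Longrightarrow> norm (circ r t) = r"
  by (simp add: circ_def norm_mult)

lemma circ_nz: "0 < r \<Longrightarrow> circ r t \<noteq> 0"
  by (simp add: circ_def)

lemma continuous_on_circ [continuous_intros]:
  "continuous_on A f \<Longrightarrow> continuous_on A (\<lambda>x. circ r (f x))"
  unfolding circ_def by (intro continuous_intros)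

lemma circlepath_circ: "circlepath 0 r t = circ r t"
  by (simp add: circlepath circ_def)

lemma vector_derivative_circ:
  assumes "0 \<le> t" "t \<le> 1"
  shows "vector_derivative (circlepath 0 r) (at t within {0..1}) = 2 * pi * \<i> * circ r t"
  using assms by (simp add: vector_derivative_circlepath01 circ_def)

lemma cauchy_formula_circ:
  assumes "f holomorphic_on cball 0 r" "norm w < r"
  shows "f w = integral {0..1} (\<lambda>t. f (circ r t) * circ r t / (circ r t - w))"
proof -
  have r: "0 < r" using assms(2) norm_ge_zero[of w] by linarith
  have "((\<lambda>u. f u / (u - w)) has_contour_integral (2 * of_real pi * \<i> * f w)) (circlepath 0 r)"
    by (rule Cauchy_integral_circlepath)
       (use assms in \<open>auto intro: holomorphic_on_imp_continuous_on holomorphic_on_subset\<close>)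
  hence "((\<lambda>t. f (circ r t) / (circ r t - w) * (2 * pi * \<i> * circ r t)) has_integral (2 * of_real pi * \<i> * f w)) {0..1}"
    unfolding has_contour_integral_def
    by (rule has_integral_eq[rotated]) (simp add: vector_derivative_circ circlepath_circ)
  from has_integral_mult_right[OF this, of "1 / (2 * of_real pi * \<i>)"]
  have "((\<lambda>t. f (circ r t) * circ r t / (circ r t - w)) has_integral f w) {0..1}"
    by (simp add: field_simps)
  thus ?thesis by (simp add: integral_unique)
qed

lemma cauchy_derivative_circ:
  assumes "f holomorphic_on cball 0 r" "0 < r"
  shows "deriv f 0 = integral {0..1} (\<lambda>t. f (circ r t) / circ r t)"
proof -
  have *: "continuous_on (cball 0 r) f" "f holomorphic_on ball 0 r" "0 \<in> ball 0 r"
    using assms by (auto intro: holomorphic_on_imp_continuous_on holomorphic_on_subset)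
  have 1: "deriv f 0 = 1 / (2 * of_real pi * \<i>) * contour_integral (circlepath 0 r) (\<lambda>u. f u/(u-0)^2)"
    by (rule DERIV_imp_deriv[OF Cauchy_derivative_integral_circlepath(2)[OF *]])
  have "((\<lambda>u. f u/(u-0)^2) has_contour_integral (2 * of_real pi * \<i> * deriv f 0)) (circlepath 0 r)"
    using Cauchy_derivative_integral_circlepath(1)[OF *] 1
    by (simp add: has_contour_integral_integral)
  hence "((\<lambda>t. f (circ r t) / (circ r t)^2 * (2 * pi * \<i> * circ r t)) has_integral (2 * of_real pi * \<i> * deriv f 0)) {0..1}"
    unfolding has_contour_integral_def
    by (rule has_integral_eq[rotated]) (simp add: vector_derivative_circ circlepath_circ)
  from has_integral_mult_right[OF this, of "1 / (2 * of_real pi * \<i>)"]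
  have "((\<lambda>t. f (circ r t) / circ r t) has_integral deriv f 0) {0..1}"
    using assms(2) by (simp add: field_simps power2_eq_square circ_nz)
  thus ?thesis by (simp add: integral_unique)
qed

lemma continuous_on_slice:
  assumes "continuous_on (S \<times> T) f" "z \<in> S"
  shows "continuous_on T (\<lambda>t. f (z, t))"
proof -
  have "continuous_on T (\<lambda>t. (z, t))"
    by (intro continuous_on_Pair continuous_on_const continuous_on_id)
  with assms show ?thesis by (elim continuous_on_compose2) auto
qed

text \<open>
  The derivative is assumed to be continuous only direction by direction. In finite dimension this
  is continuity in the operator norm, which the Leibniz rule needs.
\<close>

lemma has_derivative_integral_param:
  fixes f :: "complex ^ 'n \<Rightarrow> real \<Rightarrow> complex"
  assumes "open S" and z0: "z0 \<in> S"
    and der: "\<And>z t. z \<in> S \<Longrightarrow> t \<in> {a..b} \<Longrightarrow> ((\<lambda>z. f z t) has_derivative D z t) (at z)"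
    and contf: "\<And>z. z \<in> S \<Longrightarrow> continuous_on {a..b} (f z)"
    and contD: "\<And>v. continuous_on (S \<times> {a..b}) (\<lambda>(z, t). D z t v)"
  shows "((\<lambda>z. integral {a..b} (f z)) has_derivative (\<lambda>v. integral {a..b} (\<lambda>t. D z0 t v))) (at z0)"
proof -
  obtain e where e: "e > 0" "ball z0 e \<subseteq> S"
    using assms(1,2) open_contains_ball by blast
  define U where "U = ball z0 e"
  define B where "B z t = Blinfun (D z t)" for z t
  have B: "blinfun_apply (B z t) = D z t" if "z \<in> U" "t \<in> {a..b}" for z t
    unfolding B_def using der[of z t] that e
    by (auto simp: U_def intro!: bounded_linear_Blinfun_apply has_derivative_bounded_linear)
  have contB: "continuous_on (U \<times> cbox a b) (\<lambda>(z, t). B z t)"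
  proof (rule continuous_on_blinfun_componentwise)
    fix i :: "complex ^ 'n"
    have "continuous_on (U \<times> {a..b}) (\<lambda>(z, t). D z t i)"
      by (rule continuous_on_subset[OF contD]) (use e in \<open>auto simp: U_def\<close>)
    thus "continuous_on (U \<times> cbox a b) (\<lambda>x. blinfun_apply (case x of (z, t) \<Rightarrow> B z t) i)"
      by (subst continuous_on_cong[where g = "\<lambda>(z, t). D z t i"]) (auto simp: B)
  qed
  have U0: "z0 \<in> U" "open U" using e by (auto simp: U_def)
  have "((\<lambda>z. integral (cbox a b) (f z)) has_derivative blinfun_apply (integral (cbox a b) (B z0))) (at z0 within U)"
  proof (rule leibniz_rule)
    show "((\<lambda>z. f z t) has_derivative blinfun_apply (B z t)) (at z within U)"
      if "z \<in> U" "t \<in> cbox a b" for z t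
      unfolding B[OF that(1) that(2)[unfolded cbox_interval]]
      by (rule has_derivative_at_withinI, rule der) (use that e in \<open>auto simp: U_def\<close>)
    show "f z integrable_on cbox a b" if "z \<in> U" for z
      unfolding cbox_interval
      by (rule integrable_continuous_interval, rule contf) (use that e in \<open>auto simp: U_def\<close>)
    show "convex U" by (simp add: U_def)
  qed (rule contB, rule U0(1))
  hence *: "((\<lambda>z. integral {a..b} (f z)) has_derivative blinfun_apply (integral {a..b} (B z0))) (at z0)"
    unfolding at_within_open[OF U0] cbox_interval .
  have "blinfun_apply (integral {a..b} (B z0)) v = integral {a..b} (\<lambda>t. D z0 t v)" for v
  proof -
    have "continuous_on {a..b} (\<lambda>t. B z0 t)"
      using continuous_on_slice[OF contB U0(1)] by simp
    hence "B z0 integrable_on {a..b}" by (rule integrable_continuous_interval)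
    hence "blinfun_apply (integral {a..b} (B z0)) v = integral {a..b} (\<lambda>t. blinfun_apply (B z0 t) v)"
      by (rule blinfun_apply_integral)
    also have "\<dots> = integral {a..b} (\<lambda>t. D z0 t v)"
      by (rule integral_cong) (use U0 in \<open>simp add: B\<close>)
    finally show ?thesis .
  qed
  hence "blinfun_apply (integral {a..b} (B z0)) = (\<lambda>v. integral {a..b} (\<lambda>t. D z0 t v))"
    by (rule ext)
  with * show ?thesis by metis
qed

lemma holomorphic_funI:
  assumes "\<And>z. z \<in> S \<Longrightarrow> (h has_derivative D z) (at z)"
    and "\<And>z. z \<in> S \<Longrightarrow> Vector_Spaces.linear (*s) (*) (D z)"
  shows "holomorphic_fun_on h S"
  using assms unfolding holomorphic_fun_on_def by blast

lemma
  assumes "holomorphic_fun_on h S" "z \<in> S"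
  shows holomorphic_fun_has_derivative: "(h has_derivative d_fun h z) (at z)"
    and linear_d_fun: "Vector_Spaces.linear (*s) (*) (d_fun h z)"
proof -
  obtain D where D: "Vector_Spaces.linear (*s) (*) D" "(h has_derivative D) (at z)"
    using assms unfolding holomorphic_fun_on_def by blast
  hence "d_fun h z = D" unfolding d_fun_def using frechet_derivative_at by force
  with D show "(h has_derivative d_fun h z) (at z)" "Vector_Spaces.linear (*s) (*) (d_fun h z)"
    by auto
qed

lemma holomorphic_integral_param:
  fixes f :: "complex ^ 'n \<Rightarrow> real \<Rightarrow> complex"
  assumes "open S"
    and der: "\<And>z t. z \<in> S \<Longrightarrow> t \<in> {a..b} \<Longrightarrow> ((\<lambda>z. f z t) has_derivative D z t) (at z)"
    and lin: "\<And>z t. z \<in> S \<Longrightarrow> t \<in> {a..b} \<Longrightarrow> Vector_Spaces.linear (*s) (*) (D z t)"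
    and contf: "\<And>z. z \<in> S \<Longrightarrow> continuous_on {a..b} (f z)"
    and contD: "\<And>v. continuous_on (S \<times> {a..b}) (\<lambda>(z, t). D z t v)"
  shows "holomorphic_fun_on (\<lambda>z. integral {a..b} (f z)) S"
proof (rule holomorphic_funI)
  fix z assume z: "z \<in> S"
  show "((\<lambda>z. integral {a..b} (f z)) has_derivative (\<lambda>v. integral {a..b} (\<lambda>t. D z t v))) (at z)"
    by (rule has_derivative_integral_param[OF assms(1) z der contf contD])
  have int: "(\<lambda>t. D z t v) integrable_on {a..b}" for v
    using continuous_on_slice[OF contD[of v] z]
    by (intro integrable_continuous_interval) simp
  have "integral {a..b} (\<lambda>t. D z t (u + v)) = integral {a..b} (\<lambda>t. D z t u) + integral {a..b} (\<lambda>t. D z t v)" for u v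
    unfolding integral_add[OF int int, symmetric]
    by (rule integral_cong) (use lin[OF z] in \<open>simp add: Vector_Spaces.linear_iff\<close>)
  moreover have "integral {a..b} (\<lambda>t. D z t (c *s v)) = c * integral {a..b} (\<lambda>t. D z t v)" for c v
    unfolding integral_mult_right[symmetric]
    by (rule integral_cong) (use lin[OF z] in \<open>simp add: Vector_Spaces.linear_iff\<close>)
  ultimately show "Vector_Spaces.linear (*s) (*) (\<lambda>v. integral {a..b} (\<lambda>t. D z t v))"
    by (simp add: Vector_Spaces.linear_iff vec.vector_space_axioms vector_space_over_itself.vector_space_axioms)
qed

lemma locally_holomorphic_fun:
  assumes "\<And>z. z \<in> S \<Longrightarrow> \<exists>U g. open U \<and> z \<in> U \<and> holomorphic_fun_on g U \<and> (\<forall>x\<in>U. g x = h x)"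
  shows "holomorphic_fun_on h S"
  unfolding holomorphic_fun_on_def
proof
  fix z assume "z \<in> S"
  then obtain U g where U: "open U" "z \<in> U" "holomorphic_fun_on g U" "\<And>x. x \<in> U \<Longrightarrow> g x = h x"
    using assms by metis
  then obtain D where D: "Vector_Spaces.linear (*s) (*) D" "(g has_derivative D) (at z)"
    unfolding holomorphic_fun_on_def by blast
  from D(2) U(1,2,4) have "(h has_derivative D) (at z)"
    by (rule has_derivative_transform_within_open)
  with D(1) show "\<exists>D. Vector_Spaces.linear (*s) (*) D \<and> (h has_derivative D) (at z)"
    by blast
qed

lemma d_funI: "(h has_derivative D) (at z) \<Longrightarrow> d_fun h z = D"
  unfolding d_fun_def using frechet_derivative_at by force

lemma d_fun_scale:
  assumes "holomorphic_fun_on h S" "z \<in> S"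
  shows "d_fun h z (c *s v) = c * d_fun h z v"
  using linear_d_fun[OF assms] by (simp add: Vector_Spaces.linear_iff)

lemma isCont_holomorphic_fun:
  assumes "holomorphic_fun_on h S" "z \<in> S"
  shows "isCont h z"
  using has_derivative_continuous[OF holomorphic_fun_has_derivative[OF assms]] .

lemma continuous_on_holomorphic_fun:
  assumes "holomorphic_fun_on h S"
  shows "continuous_on S h"
  by (intro continuous_at_imp_continuous_on ballI isCont_holomorphic_fun[OF assms])

lemma holomorphic_fun_on_subset: "holomorphic_fun_on h S \<Longrightarrow> T \<subseteq> S \<Longrightarrow> holomorphic_fun_on h T"
  unfolding holomorphic_fun_on_def by blast

lemma has_derivative_line:
  fixes z v :: "complex ^ 'n"
  shows "((\<lambda>s. z + s *s v) has_derivative (\<lambda>s. s *s v)) F"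
proof -
  have "bounded_linear (\<lambda>s. s *s v)"
    by (rule linear_conv_bounded_linear[THEN iffD1])
       (auto intro!: linearI simp: vec_eq_iff algebra_simps)
  thus ?thesis by (intro derivative_eq_intros) (auto intro: bounded_linear_imp_has_derivative)
qed

lemma continuous_on_smult_vec [continuous_intros]:
  fixes g :: "'a::topological_space \<Rightarrow> complex ^ 'n"
  shows "continuous_on A f \<Longrightarrow> continuous_on A g \<Longrightarrow> continuous_on A (\<lambda>x. f x *s g x)"
  unfolding vector_scalar_mult_def by (intro continuous_intros)

lemma has_field_derivative_along_line:
  assumes "holomorphic_fun_on h S" "z + s *s v \<in> S"
  shows "((\<lambda>s. h (z + s *s v)) has_field_derivative d_fun h (z + s *s v) v) (at s)"
proof -
  have "((\<lambda>s. h (z + s *s v)) has_derivative (\<lambda>c. d_fun h (z + s *s v) (c *s v))) (at s)"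
    by (rule has_derivative_compose[OF has_derivative_line holomorphic_fun_has_derivative[OF assms]])
  thus ?thesis
    by (simp add: has_field_derivative_def d_fun_scale[OF assms] mult.commute[of _ "d_fun h (z + s *s v) v"])
qed

lemma holomorphic_on_line:
  assumes "holomorphic_fun_on h S" "\<And>s. s \<in> A \<Longrightarrow> z + s *s v \<in> S"
  shows "(\<lambda>s. h (z + s *s v)) holomorphic_on A"
proof (rule holomorphic_onI)
  fix s assume "s \<in> A"
  from has_field_derivative_along_line[OF assms(1) assms(2)[OF this]]
  show "(\<lambda>s. h (z + s *s v)) field_differentiable at s within A"
    unfolding field_differentiable_def by (blast intro: has_field_derivative_at_within)
qed

lemma discs_in_open:
  fixes z0 v :: "complex ^ 'n"
  assumes "open S" "z0 \<in> S"
  obtains e r where "0 < e" "0 < r" "\<And>z s. z \<in> ball z0 e \<Longrightarrow> norm s \<le> r \<Longrightarrow> z + s *s v \<in> S"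
proof -
  let ?f = "\<lambda>p. fst p + snd p *s v"
  have "continuous_on UNIV ?f" by (intro continuous_intros)
  hence "open (?f -` S)" using assms(1) by (simp add: continuous_on_open_vimage)
  moreover have "(z0, 0) \<in> ?f -` S" using assms(2) by simp
  ultimately obtain d where d: "d > 0" "ball (z0, 0) d \<subseteq> ?f -` S"
    using open_contains_ball by blast
  show ?thesis
  proof (rule that[of "d/2" "d/3"])
    fix z s assume *: "z \<in> ball z0 (d/2)" "norm (s::complex) \<le> d/3"
    have "dist (z0, 0) (z, s) \<le> dist z0 z + dist 0 s"
      unfolding dist_Pair_Pair by (rule sqrt_sum_squares_le_sum) auto
    also have "\<dots> < d" using * d(1) by auto
    finally show "z + s *s v \<in> S" using d(2) by fastforce
  qed (use d(1) in auto)
qed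

lemma d_fun_circle:
  assumes "holomorphic_fun_on h S" "0 < r" "\<And>s. norm s \<le> r \<Longrightarrow> z + s *s v \<in> S"
  shows "d_fun h z v = integral {0..1} (\<lambda>t. h (z + circ r t *s v) / circ r t)"
proof -
  have 0: "z + 0 *s v \<in> S" by (rule assms(3)) (use assms(2) in auto)
  have "(\<lambda>s. h (z + s *s v)) holomorphic_on cball 0 r"
    by (rule holomorphic_on_line[OF assms(1)]) (use assms in auto)
  from cauchy_derivative_circ[OF this assms(2)]
  show ?thesis using has_field_derivative_along_line[OF assms(1) 0, THEN DERIV_imp_deriv] by simp
qed

text \<open>
  A holomorphic function is only assumed to be differentiable at each point. The continuity of
  the derivative comes from Cauchy's formula on a small disc in the direction \<open>v\<close>, as does its
  holomorphy in the next lemma, where the integrand is differentiated.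
\<close>

lemma continuous_on_d_fun:
  assumes h: "holomorphic_fun_on h S" and "open S"
  shows "continuous_on S (\<lambda>z. d_fun h z v)"
proof (rule continuous_at_imp_continuous_on, rule ballI)
  fix z0 assume "z0 \<in> S"
  then obtain e r where er: "0 < e" "0 < r" "\<And>z s. z \<in> ball z0 e \<Longrightarrow> norm s \<le> r \<Longrightarrow> z + s *s v \<in> S"
    using discs_in_open[OF \<open>open S\<close>] by metis
  have "continuous_on (ball z0 e) (\<lambda>z. integral (cbox 0 1) (\<lambda>t. h (z + circ r t *s v) / circ r t))"
    by (rule integral_continuous_on_param)
       (use er in \<open>auto simp: norm_circ circ_nz split_beta intro!: continuous_intros
          continuous_on_compose2[OF continuous_on_holomorphic_fun[OF h]]\<close>)
  hence "continuous_on (ball z0 e) (\<lambda>z. d_fun h z v)"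
    by (rule continuous_on_cong[THEN iffD1, rotated 2]) (use er in \<open>auto intro!: d_fun_circle[OF h, symmetric]\<close>)
  thus "isCont (\<lambda>z. d_fun h z v) z0"
    using er(1) by (simp add: continuous_on_eq_continuous_at)
qed

lemma holomorphic_d_fun:
  assumes h: "holomorphic_fun_on h S" and "open S"
  shows "holomorphic_fun_on (\<lambda>z. d_fun h z v) S"
proof (rule locally_holomorphic_fun)
  fix z0 assume "z0 \<in> S"
  then obtain e r where er: "0 < e" "0 < r" "\<And>z s. z \<in> ball z0 e \<Longrightarrow> norm s \<le> r \<Longrightarrow> z + s *s v \<in> S"
    using discs_in_open[OF \<open>open S\<close>] by metis
  let ?f = "\<lambda>z t. h (z + circ r t *s v) / circ r t"
  let ?D = "\<lambda>z t w. d_fun h (z + circ r t *s v) w / circ r t"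
  have in_S: "z + circ r t *s v \<in> S" if "z \<in> ball z0 e" for z t
    using er that by (simp add: norm_circ)
  have "holomorphic_fun_on (\<lambda>z. integral {0..1} (?f z)) (ball z0 e)"
  proof (rule holomorphic_integral_param[where D = ?D])
    fix z t assume z: "z \<in> ball z0 e"
    have "((\<lambda>z. z + circ r t *s v) has_derivative (\<lambda>x. x)) (at z)"
      by (auto intro!: derivative_eq_intros)
    from has_derivative_compose[OF this holomorphic_fun_has_derivative[OF h in_S[OF z]]]
    show "((\<lambda>z. ?f z t) has_derivative ?D z t) (at z)"
      using circ_nz[OF er(2)] by (auto intro!: derivative_eq_intros simp: field_simps)
    show "Vector_Spaces.linear (*s) (*) (?D z t)"
      using linear_d_fun[OF h in_S[OF z]]
      by (auto simp: Vector_Spaces.linear_iff vec.vector_space_axioms vector_space_over_itself.vector_space_axioms add_divide_distrib)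
  next
    fix z assume "z \<in> ball z0 e"
    thus "continuous_on {0..1} (?f z)"
      using in_S circ_nz[OF er(2)]
      by (auto intro!: continuous_intros continuous_on_compose2[OF continuous_on_holomorphic_fun[OF h]])
  next
    fix w
    show "continuous_on (ball z0 e \<times> {0..1}) (\<lambda>(z, t). ?D z t w)"
      unfolding split_beta using in_S circ_nz[OF er(2)]
      by (auto intro!: continuous_intros continuous_on_compose2[OF continuous_on_d_fun[OF h \<open>open S\<close>]])
  qed auto
  moreover have "integral {0..1} (?f z) = d_fun h z v" if "z \<in> ball z0 e" for z
    by (rule d_fun_circle[OF h er(2), symmetric]) (use er that in auto)
  ultimately show "\<exists>U g. open U \<and> z0 \<in> U \<and> holomorphic_fun_on g U \<and> (\<forall>z\<in>U. g z = d_fun h z v)"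
    using er(1) by (intro exI[of _ "ball z0 e"] exI[of _ "\<lambda>z. integral {0..1} (?f z)"]) auto
qed

lemma linear_vec_expansion:
  assumes "Vector_Spaces.linear (*s) (*) (f :: complex ^ 'n \<Rightarrow> complex)"
  shows "f v = (\<Sum>i\<in>UNIV. v $ i * f (axis i 1))"
proof -
  interpret Vector_Spaces.linear "(*s)" "(*)" f by fact
  have "f v = f (\<Sum>i\<in>UNIV. v $ i *s axis i 1)" by (simp add: basis_expansion)
  thus ?thesis by (simp only: sum scale)
qed

lemma d_fun_scale_fun:
  assumes "holomorphic_fun_on G S" "z \<in> S"
  shows "d_fun (\<lambda>z. c * G z) z v = c * d_fun G z v"
proof -
  have "((\<lambda>z. c * G z) has_derivative (\<lambda>v. c * d_fun G z v)) (at z)"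
    using holomorphic_fun_has_derivative[OF assms] by (auto intro!: derivative_eq_intros)
  from d_funI[OF this] show ?thesis by simp
qed

section \<open>Eigenfunctions of a diagonal linear map\<close>

lemma hopf_map_has_derivative: "(hopf_map \<mu> has_derivative hopf_map \<mu>) F"
proof -
  have "bounded_linear (hopf_map \<mu>)"
    by (rule linear_conv_bounded_linear[THEN iffD1])
       (auto intro!: linearI simp: hopf_map_def vec_eq_iff algebra_simps)
  thus ?thesis by (rule bounded_linear_imp_has_derivative)
qed

lemma hopf_map_axis: "hopf_map \<mu> (axis s c) = \<mu> $ s *s axis s c"
  by (auto simp: hopf_map_def vec_eq_iff axis_def)

lemma d_fun_hopf_map:
  assumes G: "holomorphic_fun_on G UNIV" and eq: "\<And>z. G (hopf_map \<mu> z) = c * G z"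
  shows "d_fun G (hopf_map \<mu> z) (hopf_map \<mu> v) = c * d_fun G z v"
proof -
  have "((\<lambda>z. G (hopf_map \<mu> z)) has_derivative (\<lambda>v. d_fun G (hopf_map \<mu> z) (hopf_map \<mu> v))) (at z)"
    by (rule has_derivative_compose[OF hopf_map_has_derivative holomorphic_fun_has_derivative[OF G]]) simp
  from d_funI[OF this] show ?thesis
    using d_fun_scale_fun[OF G, of z c v] by (simp add: eq fun_eq_iff)
qed

lemma partial_hopf_map:
  assumes G: "holomorphic_fun_on G UNIV" and eq: "\<And>z. G (hopf_map \<mu> z) = c * G z"
    and nz: "\<mu> $ s \<noteq> 0"
  shows "d_fun G (hopf_map \<mu> z) (axis s 1) = c / \<mu> $ s * d_fun G z (axis s 1)"
  using d_fun_hopf_map[OF G eq, of z "axis s 1"] nz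
  by (simp add: hopf_map_axis d_fun_scale[OF G] field_simps)

text \<open>
  The iterated derivatives in direction \<open>v\<close> are the derivatives of the restriction to a line.
\<close>

lemma partials_determine_entire:
  assumes G: "holomorphic_fun_on (G :: complex ^ 'n \<Rightarrow> complex) UNIV"
    and "\<And>k. ((\<lambda>G z. d_fun G z v) ^^ k) G z = 0"
  shows "G (z + s *s v) = 0"
proof -
  let ?P = "\<lambda>G z. d_fun G z v"
  let ?f = "\<lambda>s. G (z + s *s v)"
  have hol: "holomorphic_fun_on ((?P ^^ k) G) UNIV" for k
    by (induction k) (use G in \<open>auto intro: holomorphic_d_fun\<close>)
  have "(deriv ^^ k) ?f s = (?P ^^ k) G (z + s *s v)" for k s
  proof (induction k arbitrary: s)
    case (Suc k)
    have "(deriv ^^ k) ?f = (\<lambda>s. (?P ^^ k) G (z + s *s v))"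
      by (rule ext) (rule Suc.IH)
    hence "(deriv ^^ Suc k) ?f s = deriv (\<lambda>s. (?P ^^ k) G (z + s *s v)) s"
      by (simp only: funpow.simps o_apply)
    also have "\<dots> = d_fun ((?P ^^ k) G) (z + s *s v) v"
      by (rule DERIV_imp_deriv[OF has_field_derivative_along_line[OF hol]]) simp
    finally show ?case by simp
  qed simp
  hence "(deriv ^^ k) ?f 0 = 0" for k using assms(2)[of k] by simp
  thus ?thesis
    by (rule holomorphic_fun_eq_0_on_connected[of ?f UNIV 0, rotated 3])
       (auto intro: holomorphic_on_line[OF G])
qed

text \<open>
  If \<open>G\<close> is nonzero at a point supported on the coordinates \<open>S\<close>, expand it in powers of one of
  these coordinates, \<open>s\<close>. Some coefficient is nonzero, and it is again an eigenfunction, with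
  eigenvalue \<open>c / \<mu>\<^sub>s\<^sup>k\<close>, on the remaining coordinates. When no coordinate is left, the point is the
  fixed point \<open>0\<close>, which forces the eigenvalue \<open>1\<close>. The coefficients are represented by iterated
  partial derivatives, so that they stay functions of all the coordinates.
\<close>

lemma eigenvalue_is_monomial:
  assumes "finite S" and nz: "\<And>i. \<mu> $ i \<noteq> 0"
    and "holomorphic_fun_on (G :: complex ^ 'n \<Rightarrow> complex) UNIV"
    and "\<And>z. G (hopf_map \<mu> z) = c * G z"
    and "G z0 \<noteq> 0" and "\<And>i. i \<notin> S \<Longrightarrow> z0 $ i = 0"
  shows "\<exists>\<alpha> :: 'n \<Rightarrow> nat. (\<forall>i. i \<notin> S \<longrightarrow> \<alpha> i = 0) \<and> c = (\<Prod>i\<in>UNIV. \<mu> $ i ^ \<alpha> i)"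
  using assms(1,3-)
proof (induction S arbitrary: G c z0 rule: finite_induct)
  case empty
  hence "z0 = 0" by (simp add: vec_eq_iff)
  moreover have "hopf_map \<mu> 0 = 0" by (simp add: hopf_map_def vec_eq_iff)
  ultimately have "c = 1" using empty(2)[of 0] empty(3) by simp
  thus ?case by (intro exI[of _ "\<lambda>_. 0"]) simp
next
  case (insert s S)
  let ?P = "\<lambda>G z. d_fun G z (axis s (1::complex))"
  define z' where "z' = z0 - z0 $ s *s axis s 1"
  have z': "z' $ i = 0" if "i \<notin> S" for i
    using insert.prems(4)[of i] that by (cases "i = s") (auto simp: z'_def axis_def)
  have "z0 = z' + z0 $ s *s axis s 1" by (simp add: z'_def)
  with insert.prems(1,3) obtain k where k: "(?P ^^ k) G z' \<noteq> 0"
    by (metis partials_determine_entire)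
  have hol: "holomorphic_fun_on ((?P ^^ k) G) UNIV" for k
    by (induction k) (use insert.prems in \<open>auto intro: holomorphic_d_fun\<close>)
  have "(?P ^^ k) G (hopf_map \<mu> z) = c / \<mu> $ s ^ k * (?P ^^ k) G z" for k z
  proof (induction k arbitrary: z)
    case (Suc k)
    show ?case
      using partial_hopf_map[OF hol[of k] Suc.IH nz, of z] by (simp add: mult_ac)
  qed (use insert.prems in simp)
  from insert.IH[OF hol this k z'] obtain \<alpha> :: "'n \<Rightarrow> nat"
    where \<alpha>: "\<And>i. i \<notin> S \<Longrightarrow> \<alpha> i = 0" "c / \<mu> $ s ^ k = (\<Prod>i\<in>UNIV. \<mu> $ i ^ \<alpha> i)"
    by blast
  have "c = \<mu> $ s ^ k * (\<Prod>i\<in>UNIV. \<mu> $ i ^ \<alpha> i)"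
    using \<alpha>(2) nz[of s] by (simp add: field_simps)
  also have "\<dots> = \<mu> $ s ^ k * (\<mu> $ s ^ \<alpha> s * (\<Prod>i\<in>UNIV - {s}. \<mu> $ i ^ \<alpha> i))"
    by (subst prod.remove[of UNIV s]) auto
  also have "\<alpha> s = 0" using \<alpha>(1) insert.hyps by simp
  also have "\<mu> $ s ^ k * (\<mu> $ s ^ 0 * (\<Prod>i\<in>UNIV - {s}. \<mu> $ i ^ \<alpha> i)) = (\<Prod>i\<in>UNIV. \<mu> $ i ^ (\<alpha>(s := k)) i)"
    by (subst prod.remove[of UNIV s]) (auto intro!: prod.cong)
  finally show ?case
    using \<alpha>(1) by (intro exI[of _ "\<alpha>(s := k)"]) auto
qed

section \<open>Extension across the origin and the Poincare lemma\<close>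

text \<open>
  Replace the coordinate \<open>s\<close> by a variable \<open>\<zeta>\<close> on the unit circle. This keeps the argument in
  \<open>W\<close>, even near the origin, so the Cauchy integral \<open>F\<close> over \<open>\<zeta>\<close> is holomorphic where
  \<open>\<bar>z\<^sub>s\<bar> < 1\<close>. It reproduces \<open>g\<close> on the lines parallel to the axis \<open>s\<close>, except on that axis itself,
  where the agreement follows by continuity. Here a second coordinate \<open>k\<close> is used.
\<close>

lemma hartogs_extension:
  fixes g :: "complex ^ 'n \<Rightarrow> complex"
  assumes g: "holomorphic_fun_on g W" and card: "CARD('n) \<ge> 2"
  obtains G where "holomorphic_fun_on G UNIV" "\<And>z. z \<in> W \<Longrightarrow> G z = g z"
proof -
  obtain s :: 'n where True by blast
  have "UNIV \<noteq> {s}" using card by (metis card_1_singleton_iff One_nat_def not_less_eq_eq numeral_2_eq_2 order_refl)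
  then obtain k where "k \<noteq> s" by blast
  let ?e = "axis s (1::complex)" and ?c = "circ 1"
  let ?p = "\<lambda>z t. z + (?c t - z $ s) *s ?e"
  let ?q = "\<lambda>z t. ?c t / (?c t - z $ s)"
  define U where "U = {z :: complex ^ 'n. norm (z $ s) < 1}"
  define F where "F z = integral {0..1} (\<lambda>t. g (?p z t) * ?q z t)" for z
  have openU: "open U" unfolding U_def by (intro open_Collect_less continuous_intros)
  have pW: "?p z t \<in> W" for z t
  proof -
    have "?p z t $ s = ?c t" by (simp add: axis_def)
    hence "?p z t \<noteq> 0" using circ_nz[of 1 t] by (metis zero_index zero_less_one)
    thus ?thesis by (simp add: W_def)
  qed
  have nz: "?c t - z $ s \<noteq> 0" if "z \<in> U" for z t
    using that norm_circ[of 1 t] by (auto simp: U_def)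
  have "holomorphic_fun_on F U"
    unfolding F_def
  proof (rule holomorphic_integral_param[OF openU, where D = "\<lambda>z t w.
      g (?p z t) * (w $ s * (?c t / (?c t - z $ s)^2)) + d_fun g (?p z t) (w - w $ s *s ?e) * ?q z t"])
    fix z t assume z: "z \<in> U"
    have nth: "((\<lambda>z. z $ s) has_derivative (\<lambda>w. w $ s)) (at z)"
      by (rule bounded_linear_imp_has_derivative) (rule bounded_linear_vec_nth)
    have "bounded_linear (\<lambda>w. w - w $ s *s ?e)"
      by (rule linear_conv_bounded_linear[THEN iffD1])
         (auto intro!: linearI simp: vec_eq_iff algebra_simps)
    hence "((\<lambda>z. ?c t *s ?e + (z - z $ s *s ?e)) has_derivative (\<lambda>w. 0 + (w - w $ s *s ?e))) (at z)"
      by (intro has_derivative_add has_derivative_const bounded_linear_imp_has_derivative)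
    hence "((\<lambda>z. ?p z t) has_derivative (\<lambda>w. w - w $ s *s ?e)) (at z)"
      by (simp add: vec.scale_left_diff_distrib algebra_simps)
    from has_derivative_compose[OF this holomorphic_fun_has_derivative[OF g pW]]
    have "((\<lambda>z. g (?p z t)) has_derivative (\<lambda>w. d_fun g (?p z t) (w - w $ s *s ?e))) (at z)" .
    moreover have "((\<lambda>x. ?c t / (?c t - x)) has_field_derivative ?c t / (?c t - z $ s)^2) (at (z $ s))"
      using nz[OF z, of t] by (auto intro!: derivative_eq_intros simp: power2_eq_square)
    from has_derivative_compose[OF nth this[unfolded has_field_derivative_def]]
    have "((\<lambda>z. ?q z t) has_derivative (\<lambda>w. w $ s * (?c t / (?c t - z $ s)^2))) (at z)"
      by (simp only: mult.commute)
    ultimately show "((\<lambda>z. g (?p z t) * ?q z t) has_derivative (\<lambda>w.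
      g (?p z t) * (w $ s * (?c t / (?c t - z $ s)^2)) + d_fun g (?p z t) (w - w $ s *s ?e) * ?q z t)) (at z)"
      by (rule has_derivative_mult)
    interpret Vector_Spaces.linear "(*s)" "(*)" "d_fun g (?p z t)" by (rule linear_d_fun[OF g pW])
    show "Vector_Spaces.linear (*s) (*) (\<lambda>w. 
      g (?p z t) * (w $ s * (?c t / (?c t - z $ s)^2)) + d_fun g (?p z t) (w - w $ s *s ?e) * ?q z t)"
    proof -
      have "(x + y) - (x + y) $ s *s ?e = (x - x $ s *s ?e) + (y - y $ s *s ?e)" for x y
        by (simp add: vec_eq_iff algebra_simps)
      moreover have "(c *s x) - (c *s x) $ s *s ?e = c *s (x - x $ s *s ?e)" for c x
        by (simp add: vec_eq_iff algebra_simps)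
      ultimately show ?thesis
        unfolding Vector_Spaces.linear_iff
        by (simp only: add scale vector_add_component vector_smult_component
            vec.vector_space_axioms vector_space_over_itself.vector_space_axioms)
           (simp add: algebra_simps add_divide_distrib)
    qed
  next
    show "continuous_on {0..1} (\<lambda>t. g (?p z t) * ?q z t)" if "z \<in> U" for z
      using nz[OF that] pW
      by (auto intro!: continuous_intros continuous_on_compose2[OF continuous_on_holomorphic_fun[OF g]])
  next
    fix w
    show "continuous_on (U \<times> {0..1}) (\<lambda>(z, t). g (?p z t) * (w $ s * (?c t / (?c t - z $ s)^2)) + d_fun g (?p z t) (w - w $ s *s ?e) * ?q z t)"
      unfolding split_beta using nz pW
      by (auto intro!: continuous_intros continuous_on_compose2[OF continuous_on_d_fun[OF g]]
          continuous_on_compose2[OF continuous_on_holomorphic_fun[OF g]] simp: W_def)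
  qed
  have off_axis: "F z = g z" if "z \<in> U" "z $ k \<noteq> 0" for z
  proof -
    let ?z = "z - z $ s *s ?e"
    have "?z + u *s ?e \<in> W" for u
    proof -
      have "(?z + u *s ?e) $ k = z $ k" using \<open>k \<noteq> s\<close> by (simp add: axis_def)
      with that have "?z + u *s ?e \<noteq> 0" by (metis zero_index)
      thus ?thesis by (simp add: W_def)
    qed
    hence "(\<lambda>u. g (?z + u *s ?e)) holomorphic_on cball 0 1" by (intro holomorphic_on_line[OF g])
    from cauchy_formula_circ[OF this, of "z $ s"] that
    show ?thesis by (simp add: U_def F_def algebra_simps)
  qed
  have eq: "F z = g z" if "z \<in> U" "z \<in> W" for z
  proof -
    let ?a = "axis k (1::complex)"
    have lim: "((\<lambda>u. z + u *s ?a) \<longlongrightarrow> z) (at 0)"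
    proof -
      have "continuous_on UNIV (\<lambda>u. z + u *s ?a)" by (intro continuous_intros)
      hence "isCont (\<lambda>u. z + u *s ?a) 0" by (simp add: continuous_on_eq_continuous_at)
      thus ?thesis by (simp add: isCont_def)
    qed
    have "isCont F z" by (rule isCont_holomorphic_fun) fact+
    hence F: "((\<lambda>u. F (z + u *s ?a)) \<longlongrightarrow> F z) (at 0)"
      using lim by (rule isCont_tendsto_compose)
    have "isCont g z" by (rule isCont_holomorphic_fun[OF g]) fact
    hence g: "((\<lambda>u. g (z + u *s ?a)) \<longlongrightarrow> g z) (at 0)"
      using lim by (rule isCont_tendsto_compose)
    have "\<forall>\<^sub>F u in at 0. F (z + u *s ?a) = g (z + u *s ?a)"
    proof -
      have "\<forall>\<^sub>F u in at 0. u \<noteq> - z $ k"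
        by (rule eventually_neq_at_within)
      moreover have "z + u *s ?a \<in> U" for u
        using that \<open>k \<noteq> s\<close> by (simp add: U_def axis_def)
      ultimately show ?thesis
        by (elim eventually_mono) (rule off_axis, auto simp: axis_def eq_neg_iff_add_eq_0 add.commute)
    qed
    with F have "((\<lambda>u. g (z + u *s ?a)) \<longlongrightarrow> F z) (at 0)" by (simp add: tendsto_cong)
    from tendsto_unique[OF _ this g] show ?thesis by simp
  qed
  show ?thesis
  proof (rule that)
    let ?G = "\<lambda>z. if z = 0 then F 0 else g z"
    show "holomorphic_fun_on ?G UNIV"
    proof (rule locally_holomorphic_fun)
      fix z :: "complex ^ 'n"
      show "\<exists>V f. open V \<and> z \<in> V \<and> holomorphic_fun_on f V \<and> (\<forall>x\<in>V. f x = ?G x)"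
      proof (cases "z = 0")
        case True
        with openU eq \<open>holomorphic_fun_on F U\<close> show ?thesis
          by (intro exI[of _ U] exI[of _ F]) (auto simp: U_def W_def)
      next
        case False
        with g show ?thesis
          by (intro exI[of _ W] exI[of _ g]) (auto simp: W_def)
      qed
    qed
  qed (simp add: W_def)
qed

lemma d_fun_form_expansion:
  assumes \<Omega>: "holomorphic_one_form_on (\<Omega> :: complex ^ 'n \<Rightarrow> complex ^ 'n \<Rightarrow> complex) S"
    and z: "z \<in> S" "open S"
  shows "d_fun (\<lambda>x. \<Omega> x v) z u = (\<Sum>i\<in>UNIV. v $ i * d_fun (\<lambda>x. \<Omega> x (axis i 1)) z u)"
proof -
  have "((\<lambda>x. \<Sum>i\<in>UNIV. v $ i * \<Omega> x (axis i 1)) has_derivative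
      (\<lambda>u. \<Sum>i\<in>UNIV. v $ i * d_fun (\<lambda>x. \<Omega> x (axis i 1)) z u)) (at z)"
    using \<Omega> z unfolding holomorphic_one_form_on_def
    by (auto intro!: derivative_eq_intros holomorphic_fun_has_derivative)
  hence "((\<lambda>x. \<Omega> x v) has_derivative
      (\<lambda>u. \<Sum>i\<in>UNIV. v $ i * d_fun (\<lambda>x. \<Omega> x (axis i 1)) z u)) (at z)"
    using z(2,1)
    by (rule has_derivative_transform_within_open)
       (use \<Omega> in \<open>auto simp: holomorphic_one_form_on_def intro: linear_vec_expansion[symmetric]\<close>)
  from d_funI[OF this] show ?thesis by simp
qed

text \<open>
  The primitive is the integral of \<open>\<Omega>\<close> along segments from the origin. By closedness the
  integrand of its derivative in direction \<open>w\<close> is the derivative of \<open>t \<Omega>\<^sub>t\<^sub>z(w)\<close> with respect to \<open>t\<close>.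
\<close>

lemma closed_form_exact:
  assumes \<Omega>: "holomorphic_one_form_on (\<Omega> :: complex ^ 'n \<Rightarrow> complex ^ 'n \<Rightarrow> complex) UNIV"
    and closed: "\<And>z u v. d_one_form \<Omega> z u v = 0"
  obtains h where "\<And>z. (h has_derivative \<Omega> z) (at z)"
proof -
  have lin: "Vector_Spaces.linear (*s) (*) (\<Omega> z)" and hol: "holomorphic_fun_on (\<lambda>z. \<Omega> z v) UNIV" for z v
    using \<Omega> by (auto simp: holomorphic_one_form_on_def)
  let ?m = "\<lambda>t z. complex_of_real t *s z"
  let ?D = "\<lambda>z t w. \<Omega> (?m t z) w + of_real t * d_fun (\<lambda>x. \<Omega> x z) (?m t z) w"
  show ?thesis
  proof (rule that)
    fix z :: "complex ^ 'n"
    have *: "((\<lambda>z. integral {0..1} (\<lambda>t. \<Omega> (?m t z) z)) has_derivative (\<lambda>w. integral {0..1} (\<lambda>t. ?D z t w))) (at z)"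
    proof (rule has_derivative_integral_param[of UNIV])
      fix z :: "complex ^ 'n" and t :: real
      have "bounded_linear (\<lambda>w :: complex ^ 'n. ?m t w)"
        by (rule linear_conv_bounded_linear[THEN iffD1])
           (auto intro!: linearI simp: vec_eq_iff algebra_simps)
      hence "((\<lambda>z. ?m t z) has_derivative (\<lambda>w. ?m t w)) (at z)"
        by (rule bounded_linear_imp_has_derivative)
      note [derivative_intros] = has_derivative_compose[OF this holomorphic_fun_has_derivative[OF hol UNIV_I]]
        bounded_linear.has_derivative[OF bounded_linear_vec_nth]
      have "((\<lambda>z. \<Sum>i\<in>UNIV. z $ i * \<Omega> (?m t z) (axis i 1)) has_derivative
          (\<lambda>w. \<Sum>i\<in>UNIV. z $ i * d_fun (\<lambda>x. \<Omega> x (axis i 1)) (?m t z) (?m t w) + w $ i * \<Omega> (?m t z) (axis i 1))) (at z)"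
        by (rule has_derivative_sum has_derivative_mult derivative_intros has_derivative_ident)+
      thus "((\<lambda>z. \<Omega> (?m t z) z) has_derivative ?D z t) (at z)"
        by (simp add: linear_vec_expansion[OF lin, symmetric] sum.distrib sum_distrib_left
            d_fun_form_expansion[OF \<Omega>, of _ z] d_fun_scale[OF hol] add.commute mult.left_commute)
    next
      have "continuous_on {0..1} (\<lambda>t. \<Sum>i\<in>UNIV. z $ i * \<Omega> (?m t z) (axis i 1))" for z
        by (intro continuous_intros continuous_on_compose2[OF continuous_on_holomorphic_fun[OF hol]]) auto
      thus "continuous_on {0..1} (\<lambda>t. \<Omega> (?m t z) z)" for z
        by (simp add: linear_vec_expansion[OF lin, symmetric])
    next
      fix w
      have "continuous_on (UNIV \<times> {0..1}) (\<lambda>(z, t). \<Omega> (?m t z) w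
          + of_real t * (\<Sum>i\<in>UNIV. z $ i * d_fun (\<lambda>x. \<Omega> x (axis i 1)) (?m t z) w))"
        unfolding split_beta
        by (intro continuous_intros continuous_on_compose2[OF continuous_on_holomorphic_fun[OF hol]]
             continuous_on_compose2[OF continuous_on_d_fun[OF hol]]) auto
      thus "continuous_on (UNIV \<times> {0..1}) (\<lambda>(z, t). ?D z t w)"
        by (simp add: d_fun_form_expansion[OF \<Omega>, symmetric])
    qed auto
    have "integral {0..1} (\<lambda>t. ?D z t w) = \<Omega> z w" for w
    proof -
      have "((\<lambda>t. complex_of_real t * \<Omega> (?m t z) w) has_vector_derivative ?D z t w) (at t within {0..1})" for t
      proof -
        have "((\<lambda>s. s * \<Omega> (s *s z) w) has_field_derivative \<Omega> (?m t z) w + of_real t * d_fun (\<lambda>x. \<Omega> x w) (?m t z) z) (at (of_real t))"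
          using has_field_derivative_along_line[where z = 0 and s = "of_real t" and v = z, OF hol[of w] UNIV_I]
          by (auto intro!: derivative_eq_intros)
        moreover have "d_fun (\<lambda>x. \<Omega> x w) (?m t z) z = d_fun (\<lambda>x. \<Omega> x z) (?m t z) w"
          using closed[of "?m t z" z w] by (simp add: d_one_form_def)
        ultimately have *: "((\<lambda>s. s * \<Omega> (s *s z) w) has_field_derivative ?D z t w) (at (of_real t))" by simp
        have "(complex_of_real has_vector_derivative 1) (at t within {0..1})"
          by (auto simp: has_vector_derivative_def scaleR_conv_of_real
              intro: bounded_linear_imp_has_derivative bounded_linear_of_real)
        from field_vector_diff_chain_within[OF this has_field_derivative_at_within[OF *]]
        show ?thesis by (simp add: o_def)
      qed
      hence "((\<lambda>t. ?D z t w) has_integral (of_real 1 * \<Omega> (?m 1 z) w - of_real 0 * \<Omega> (?m 0 z) w)) {0..1}"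
        by (intro fundamental_theorem_of_calculus) auto
      thus ?thesis by (simp add: integral_unique)
    qed
    hence "(\<lambda>w. integral {0..1} (\<lambda>t. ?D z t w)) = \<Omega> z" by (rule ext)
    from *[unfolded this]
    show "((\<lambda>z. integral {0..1} (\<lambda>t. \<Omega> (?m t z) z)) has_derivative \<Omega> z) (at z)" .
  qed
qed

section \<open>Independent multipliers\<close>

lemma d_fun_expansion:
  assumes "holomorphic_fun_on (G :: complex ^ 'n \<Rightarrow> complex) S" "z \<in> S"
  shows "d_fun G z v = (\<Sum>j\<in>UNIV. v $ j * d_fun G z (axis j 1))"
  by (rule linear_vec_expansion[OF linear_d_fun[OF assms]])

lemma entire_vanishing_partials_const:
  assumes G: "holomorphic_fun_on (G :: complex ^ 'n \<Rightarrow> complex) UNIV"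
    and "\<And>z j. d_fun G z (axis j 1) = 0"
  shows "G z = G 0"
proof -
  have "((\<lambda>s. G (0 + s *s z)) has_field_derivative 0) (at s within UNIV)" for s
    using has_field_derivative_along_line[where z = 0 and s = s and v = z, OF G UNIV_I]
    by (simp add: d_fun_expansion[OF G UNIV_I, of _ z] assms(2))
  then obtain c where "\<And>s. G (0 + s *s z) = c"
    using has_field_derivative_zero_constant[OF convex_UNIV, of "\<lambda>s. G (0 + s *s z)"] by blast
  from this[of 1] this[of 0] show ?thesis by (simp add: diff_eq_eq)
qed

lemma entire_vanishing_second_partials_affine:
  assumes G: "holomorphic_fun_on (G :: complex ^ 'n \<Rightarrow> complex) UNIV"
    and "\<And>z j k. d_fun (\<lambda>x. d_fun G x (axis j 1)) z (axis k 1) = 0"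
  shows "G z = G 0 + (\<Sum>j\<in>UNIV. z $ j * d_fun G 0 (axis j 1))"
proof -
  let ?a = "\<Sum>j\<in>UNIV. z $ j * d_fun G 0 (axis j 1)"
  have const: "d_fun G x (axis j 1) = d_fun G 0 (axis j 1)" for x j
    by (rule entire_vanishing_partials_const[OF holomorphic_d_fun[OF G]]) (use assms(2) in auto)
  have "((\<lambda>s. G (0 + s *s z)) has_field_derivative ?a) (at s)" for s
    using has_field_derivative_along_line[where z = 0 and s = s and v = z, OF G UNIV_I]
    by (simp add: d_fun_expansion[OF G UNIV_I, of _ z] const[of "s *s z"])
  hence "((\<lambda>s. G (0 + s *s z) - s * ?a) has_field_derivative 0) (at s within UNIV)" for s
    by (auto intro!: derivative_eq_intros)
  then obtain c where "\<And>s. G (0 + s *s z) - s * ?a = c"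
    using has_field_derivative_zero_constant[OF convex_UNIV, of "\<lambda>s. G (0 + s *s z) - s * ?a"] by blast
  from this[of 1] this[of 0] show ?thesis by (simp add: diff_eq_eq)
qed

text \<open>
  Cancelling common powers puts each index on the side on which its exponent is larger. This is
  the shape of relation that \<open>no_nontrivial_relation\<close> excludes.
\<close>

lemma independent_exponents_unique:
  fixes p q :: "'n::finite \<Rightarrow> nat"
  assumes ind: "no_nontrivial_relation \<mu> I" and nz: "\<And>i. \<mu> $ i \<noteq> 0"
    and eq: "(\<Prod>i\<in>I. \<mu> $ i ^ p i) = (\<Prod>i\<in>I. \<mu> $ i ^ q i)" and "j \<in> I"
  shows "p j = q j"
proof (rule ccontr)
  assume ne: "p j \<noteq> q j"
  define A where "A = {i \<in> I. q i \<le> p i}"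
  define B where "B = {i \<in> I. p i < q i}"
  define r where "r i = (p i - q i) + (q i - p i)" for i
  have AB: "A \<inter> B = {}" "A \<union> B = I" by (auto simp: A_def B_def)
  have split: "(\<Prod>i\<in>I. f i) = (\<Prod>i\<in>A. f i) * (\<Prod>i\<in>B. f i)" for f :: "'n \<Rightarrow> complex"
    using prod.union_disjoint[of A B f] AB by simp
  have pA: "(\<Prod>i\<in>A. \<mu> $ i ^ p i) = (\<Prod>i\<in>A. \<mu> $ i ^ q i) * (\<Prod>i\<in>A. \<mu> $ i ^ r i)"
    by (auto simp: A_def r_def prod.distrib[symmetric] power_add[symmetric] intro!: prod.cong)
  have qB: "(\<Prod>i\<in>B. \<mu> $ i ^ q i) = (\<Prod>i\<in>B. \<mu> $ i ^ p i) * (\<Prod>i\<in>B. \<mu> $ i ^ r i)"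
    by (auto simp: B_def r_def prod.distrib[symmetric] power_add[symmetric] intro!: prod.cong)
  have "(\<Prod>i\<in>A. \<mu> $ i ^ q i) * (\<Prod>i\<in>B. \<mu> $ i ^ p i) \<noteq> 0" using nz by simp
  hence "(\<Prod>i\<in>A. \<mu> $ i ^ r i) = (\<Prod>i\<in>B. \<mu> $ i ^ r i)"
    using eq nz unfolding split pA qB by simp
  moreover have "r j \<noteq> 0" using ne by (simp add: r_def)
  ultimately show False
    using ind \<open>j \<in> I\<close> AB unfolding no_nontrivial_relation_def by blast
qed

text \<open>
  The map \<open>\<rho>\<close> sends an index to the representative with the same multiplier. A monomial in the
  multipliers is determined by the degrees collected over the fibres of \<open>\<rho>\<close>, and, for
  independent multipliers, determines them.
\<close>

definition weight :: "('n::finite \<Rightarrow> 'n) \<Rightarrow> ('n \<Rightarrow> nat) \<Rightarrow> 'n \<Rightarrow> nat" where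
  "weight \<rho> \<alpha> j = (\<Sum>i | \<rho> i = j. \<alpha> i)"

definition times_var :: "'n \<Rightarrow> ('n \<Rightarrow> nat) \<Rightarrow> 'n \<Rightarrow> nat" where
  "times_var i \<alpha> = \<alpha>(i := Suc (\<alpha> i))"

lemma prod_times_var:
  fixes \<mu> :: "complex ^ 'n"
  shows "(\<Prod>j\<in>UNIV. \<mu> $ j ^ times_var i \<alpha> j) = \<mu> $ i * (\<Prod>j\<in>UNIV. \<mu> $ j ^ \<alpha> j)"
  by (subst (1 2) prod.remove[of UNIV i]) (auto simp: times_var_def intro!: prod.cong)

lemma sum_times_var:
  fixes i :: "'n::finite"
  shows "sum (times_var i \<alpha>) UNIV = Suc (sum \<alpha> UNIV)"
  by (subst (1 2) sum.remove[of UNIV i]) (auto simp: times_var_def intro!: sum.cong)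

lemma weight_times_var:
  "weight \<rho> (times_var i \<alpha>) j = weight \<rho> \<alpha> j + (if \<rho> i = j then 1 else 0)"
proof (cases "\<rho> i = j")
  case True
  thus ?thesis unfolding weight_def
    by (subst (1 2) sum.remove[of _ i]) (auto simp: times_var_def intro!: sum.cong)
next
  case False
  thus ?thesis unfolding weight_def by (auto simp: times_var_def intro!: sum.cong)
qed

lemma weight_unique:
  fixes \<alpha> \<beta> :: "'n::finite \<Rightarrow> nat"
  assumes ind: "no_nontrivial_relation \<mu> I" and nz: "\<And>i. \<mu> $ i \<noteq> 0"
    and \<rho>: "\<And>i. \<rho> i \<in> I" "\<And>i. \<mu> $ \<rho> i = \<mu> $ i"
    and eq: "(\<Prod>i\<in>UNIV. \<mu> $ i ^ \<alpha> i) = (\<Prod>i\<in>UNIV. \<mu> $ i ^ \<beta> i)"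
  shows "weight \<rho> \<alpha> j = weight \<rho> \<beta> j" and "sum \<alpha> UNIV = sum \<beta> UNIV"
proof -
  have fibres: "(\<Prod>i\<in>UNIV. \<mu> $ i ^ \<gamma> i) = (\<Prod>j\<in>I. \<mu> $ j ^ weight \<rho> \<gamma> j)" for \<gamma>
  proof -
    have "(\<Prod>i\<in>UNIV. \<mu> $ i ^ \<gamma> i) = (\<Prod>j\<in>I. \<Prod>i | i \<in> UNIV \<and> \<rho> i = j. \<mu> $ i ^ \<gamma> i)"
      by (rule prod.group[symmetric]) (use \<rho> in auto)
    also have "\<dots> = (\<Prod>j\<in>I. \<mu> $ j ^ weight \<rho> \<gamma> j)"
      unfolding weight_def power_sum by (intro prod.cong) (use \<rho>(2) in auto)
    finally show ?thesis .
  qed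
  have *: "weight \<rho> \<alpha> j = weight \<rho> \<beta> j" if "j \<in> I" for j
    by (rule independent_exponents_unique[OF ind nz _ that]) (use eq fibres in metis)
  have total: "sum \<gamma> UNIV = (\<Sum>j\<in>I. weight \<rho> \<gamma> j)" for \<gamma>
    unfolding weight_def using sum.group[of UNIV I \<rho> \<gamma>] \<rho>(1) by (simp add: image_subset_iff)
  show "sum \<alpha> UNIV = sum \<beta> UNIV" unfolding total by (rule sum.cong) (use * in auto)
  have "weight \<rho> \<gamma> j = 0" if "j \<notin> I" for \<gamma>
    unfolding weight_def using that \<rho>(1) by (metis (mono_tags, lifting) mem_Collect_eq sum.neutral)
  with * show "weight \<rho> \<alpha> j = weight \<rho> \<beta> j" by metis
qed

text \<open>
  The set \<open>I\<close> represents the distinct multipliers. Besides having three elements it may have two,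
  provided that one of them, \<open>q\<close>, is the multiplier of a single index and the other, \<open>p\<close>, of several;
  this is the intermediary case \<open>r = n - 1\<close>. For two indices only, \<open>z\<^sub>1 dz\<^sub>2 - z\<^sub>2 dz\<^sub>1\<close> with
  independent \<open>\<mu>\<^sub>1\<close>, \<open>\<mu>\<^sub>2\<close> vanishes only at the origin and is not closed.
\<close>

lemma nonresonant_equivariant_form_closed:
  fixes \<Omega> :: "complex ^ 'n \<Rightarrow> complex ^ 'n \<Rightarrow> complex"
  assumes \<Omega>: "holomorphic_one_form_on \<Omega> UNIV"
    and nonvanishing: "nowhere_vanishing_on \<Omega> W"
    and equivariant: "\<And>z v. \<Omega> (hopf_map \<mu> z) (hopf_map \<mu> v) = c * \<Omega> z v"
    and nz: "\<And>i. \<mu> $ i \<noteq> 0"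
    and ind: "no_nontrivial_relation \<mu> I"
    and \<rho>: "\<And>i. \<rho> i \<in> I" "\<And>i. i \<in> I \<Longrightarrow> \<rho> i = i" "\<And>i. \<mu> $ \<rho> i = \<mu> $ i"
    and size: "card I \<ge> 3 \<or> (\<exists>p q i1 i2. p \<noteq> q \<and> I = {p, q} \<and>
      i1 \<noteq> i2 \<and> \<rho> i1 = p \<and> \<rho> i2 = p \<and> (\<forall>i. \<rho> i = q \<longrightarrow> i = q))"
  shows "d_one_form \<Omega> z u v = 0"
proof -
  let ?G = "\<lambda>i z. \<Omega> z (axis i 1)"
  let ?D = "\<lambda>j G z. d_fun G z (axis j (1::complex))"
  let ?M = "\<lambda>\<alpha>. \<Prod>j\<in>UNIV. \<mu> $ j ^ \<alpha> j"
  let ?w = "weight \<rho>"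
  have lin: "Vector_Spaces.linear (*s) (*) (\<Omega> z)"
    and G: "holomorphic_fun_on (?G i) UNIV" for z i
    using \<Omega> by (auto simp: holomorphic_one_form_on_def)
  have eigG: "?G i (hopf_map \<mu> z) = c / \<mu> $ i * ?G i z" for i z
    using equivariant[of z "axis i 1"] lin[of "hopf_map \<mu> z"] nz[of i]
    by (simp add: hopf_map_axis Vector_Spaces.linear_iff field_simps)
  have DG: "holomorphic_fun_on (?D j (?G i)) UNIV" for i j
    by (rule holomorphic_d_fun[OF G]) simp
  have eigDG: "?D j (?G i) (hopf_map \<mu> z) = c / \<mu> $ i / \<mu> $ j * ?D j (?G i) z" for i j z
    by (rule partial_hopf_map[OF G eigG nz])
  have DDG: "holomorphic_fun_on (?D k (?D j (?G i))) UNIV" for i j k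
    by (rule holomorphic_d_fun[OF DG]) simp
  have eigDDG: "?D k (?D j (?G i)) (hopf_map \<mu> z) = c / \<mu> $ i / \<mu> $ j / \<mu> $ k * ?D k (?D j (?G i)) z" for i j k z
    by (rule partial_hopf_map[OF DG eigDG nz])
  \<comment> \<open>A nonzero coefficient, or nonzero derivative of one, makes \<open>c\<close> a monomial of degree one more than the number of derivatives, or larger.\<close>
  have mono0: "\<exists>\<alpha>. (\<forall>l. l \<notin> S \<longrightarrow> \<alpha> l = 0) \<and> c = ?M (times_var i \<alpha>)"
    if "?G i z \<noteq> 0" "\<And>l. l \<notin> S \<Longrightarrow> z $ l = 0" for i z S
    using eigenvalue_is_monomial[OF finite nz G eigG that] nz[of i]
    by (auto simp: prod_times_var field_simps)
  have mono1: "\<exists>\<alpha>. (\<forall>l. l \<notin> S \<longrightarrow> \<alpha> l = 0) \<and> c = ?M (times_var i (times_var j \<alpha>))"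
    if "?D j (?G i) z \<noteq> 0" "\<And>l. l \<notin> S \<Longrightarrow> z $ l = 0" for i j z S
    using eigenvalue_is_monomial[OF finite nz DG eigDG that] nz[of i] nz[of j]
    by (auto simp: prod_times_var field_simps)
  have mono2: "\<exists>\<alpha>. c = ?M (times_var i (times_var j (times_var k \<alpha>)))"
    if "?D k (?D j (?G i)) z \<noteq> 0" for i j k z
    using eigenvalue_is_monomial[OF finite nz DDG eigDDG that, of UNIV] nz[of i] nz[of j] nz[of k]
    by (auto simp: prod_times_var field_simps)
  have \<Omega>_zero: "\<exists>i. ?G i z \<noteq> 0" if "z \<noteq> 0" for z
  proof (rule ccontr)
    assume "\<nexists>i. ?G i z \<noteq> 0"
    hence "\<Omega> z v = 0" for v by (simp add: linear_vec_expansion[OF lin, of z v])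
    with nonvanishing that show False by (auto simp: nowhere_vanishing_on_def W_def)
  qed
  have axis_points: "\<exists>i m. c = ?M (times_var i ((\<lambda>_. 0)(k := m)))" for k
  proof -
    obtain i where i: "?G i (axis k 1) \<noteq> 0" using \<Omega>_zero[of "axis k 1"] by (auto simp: axis_eq_0_iff)
    then obtain \<alpha> where \<alpha>: "\<And>l. l \<notin> {k} \<Longrightarrow> \<alpha> l = 0" "c = ?M (times_var i \<alpha>)"
      using mono0[OF i, of "{k}"] by (auto simp: axis_def)
    have "\<alpha> = (\<lambda>_. 0)(k := \<alpha> k)" using \<alpha>(1) by auto
    with \<alpha>(2) show ?thesis by metis
  qed
  obtain \<alpha>0 where c: "c = ?M \<alpha>0" using axis_points by blast
  define N where "N = sum \<alpha>0 UNIV"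
  have N: "sum \<beta> UNIV = N" and w: "?w \<beta> j = ?w \<alpha>0 j" if "c = ?M \<beta>" for \<beta> j
    using weight_unique[OF ind nz \<rho>(1,3), where \<alpha> = \<beta> and \<beta> = \<alpha>0] that c
    by (auto simp: N_def)
  have sum_single: "sum ((\<lambda>_. 0)(k := m)) UNIV = m" for k :: 'n and m :: nat
    by (simp add: fun_upd_def)
  have w_single: "?w ((\<lambda>_. 0)(k := m)) j = (if \<rho> k = j then m else 0)" for k m j
    by (simp add: weight_def fun_upd_def)
  have axis_points': "\<exists>i. c = ?M (times_var i ((\<lambda>_. 0)(k := N - 1)))" and "N \<ge> 1" for k
  proof -
    obtain i m where im: "c = ?M (times_var i ((\<lambda>_. 0)(k := m)))" using axis_points by blast
    from N[OF im] have "N = Suc m" by (simp add: sum_times_var sum_single)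
    with im show "\<exists>i. c = ?M (times_var i ((\<lambda>_. 0)(k := N - 1)))" and "N \<ge> 1" by auto
  qed
  \<comment> \<open>On the \<open>k\<close>-th axis some coefficient is nonzero, so \<open>c\<close> is \<open>\<mu>\<^sub>k\<^sup>N\<^sup>-\<^sup>1\<close> times the multiplier of that coefficient's coordinate differential.\<close>
  have axis_weight: "\<exists>i. \<forall>j. ?w \<alpha>0 j = (if \<rho> k = j then N - 1 else 0) + (if \<rho> i = j then 1 else 0)" for k
  proof -
    from axis_points'(1) obtain i where "c = ?M (times_var i ((\<lambda>_. 0)(k := N - 1)))" by blast
    from w[OF this, symmetric] show ?thesis by (intro exI[of _ i]) (simp only: weight_times_var w_single simp_thms)
  qed
  have "N = 1"
  proof (rule ccontr)
    assume "N \<noteq> 1"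
    with \<open>N \<ge> 1\<close> have N1: "N - 1 \<ge> 1" by simp
    have pos: "?w \<alpha>0 k \<ge> 1" if "k \<in> I" for k
      using axis_weight[of k] \<rho>(2)[OF that] N1 by auto
    have two: "\<exists>i. \<forall>j\<in>I. j = k \<or> j = \<rho> i" if "k \<in> I" for k
    proof -
      from axis_weight obtain i where
        "\<And>j. ?w \<alpha>0 j = (if \<rho> k = j then N - 1 else 0) + (if \<rho> i = j then 1 else 0)" by blast
      with pos \<rho>(2)[OF that] show ?thesis
        by (intro exI[of _ i] ballI) (metis add_0 not_one_le_zero)
    qed
    show False using size
    proof (elim disjE exE conjE)
      assume "card I \<ge> 3"
      then obtain k where k: "k \<in> I" by fastforce
      with two obtain i where "I \<subseteq> {k, \<rho> i}" by blast
      from card_mono[OF _ this] \<open>card I \<ge> 3\<close> card_insert_le_m1[of 2 "{\<rho> i}" k] show False by simp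
    next
      fix p q i1 i2
      assume pq: "p \<noteq> q" "I = {p, q}" and i12: "i1 \<noteq> i2" "\<rho> i1 = p" "\<rho> i2 = p"
        and q: "\<forall>i. \<rho> i = q \<longrightarrow> i = q"
      have \<rho>pq: "\<rho> p = p" "\<rho> q = q" using pq \<rho>(2) by auto
      obtain i where i: "\<And>j. ?w \<alpha>0 j = (if p = j then N - 1 else 0) + (if \<rho> i = j then 1 else 0)"
        using axis_weight[of p] unfolding \<rho>pq by blast
      obtain k where k: "\<And>j. ?w \<alpha>0 j = (if q = j then N - 1 else 0) + (if \<rho> k = j then 1 else 0)"
        using axis_weight[of q] unfolding \<rho>pq by blast
      have "\<rho> i = q" using i[of q] pos[of q] pq by (simp split: if_splits)
      hence "?w \<alpha>0 q = 1" and wp: "?w \<alpha>0 p = N - 1" using i[of q] i[of p] pq by simp_all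
      hence "N = 2" using k[of q] N1 by (simp split: if_splits)
      with wp have "?w \<alpha>0 p = 1" by simp
      \<comment> \<open>Degree two and one factor of each multiplier: the coefficients are linear, mixing the two groups of coordinates.\<close>
      have G0: "?G i 0 = 0" for i
      proof (rule ccontr)
        assume "?G i 0 \<noteq> 0"
        from mono0[OF this, of "{}"] obtain \<alpha>
          where \<alpha>: "\<And>l. \<alpha> l = 0" "c = ?M (times_var i \<alpha>)" by auto
        from N[OF \<alpha>(2)] \<alpha>(1) \<open>N = 2\<close> show False by (simp add: sum_times_var)
      qed
      have DDG0: "?D k (?D j (?G i)) x = 0" for i j k x
      proof (rule ccontr)
        assume "?D k (?D j (?G i)) x \<noteq> 0"
        then obtain \<alpha> where "c = ?M (times_var i (times_var j (times_var k \<alpha>)))"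
          using mono2 by blast
        from N[OF this] \<open>N = 2\<close> show False by (simp add: sum_times_var)
      qed
      have G_linear: "?G i x = (\<Sum>j\<in>UNIV. x $ j * ?D j (?G i) 0)" for i x
        using entire_vanishing_second_partials_affine[OF G DDG0, where z = x] G0 by simp
      have DG0: "?D j (?G i) 0 = 0" if "\<rho> i = p" "\<rho> j = p" for i j
      proof (rule ccontr)
        assume "?D j (?G i) 0 \<noteq> 0"
        from mono1[OF this, of "{}"] obtain \<alpha>
          where \<alpha>: "\<And>l. \<alpha> l = 0" "c = ?M (times_var i (times_var j \<alpha>))" by auto
        from w[OF \<alpha>(2), of p] that \<open>?w \<alpha>0 p = 1\<close> show False by (simp add: weight_times_var)
      qed
      \<comment> \<open>In the plane of the coordinates \<open>i1\<close>, \<open>i2\<close> only the coefficient of index \<open>q\<close> survives, and it is a linear form in two variables.\<close>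
      obtain x y where xy: "x \<noteq> 0 \<or> y \<noteq> 0" "x * ?D i1 (?G q) 0 + y * ?D i2 (?G q) 0 = 0"
      proof (cases "?D i1 (?G q) 0 = 0")
        case True
        thus ?thesis using that[of 1 0] by simp
      next
        case False
        thus ?thesis using that[of "?D i2 (?G q) 0" "- ?D i1 (?G q) 0"] by (simp add: mult.commute)
      qed
      define P where "P = x *s axis i1 (1::complex) + y *s axis i2 1"
      have P: "P $ i1 = x" "P $ i2 = y" using i12 by (auto simp: P_def axis_def)
      hence "P \<noteq> 0" using xy(1) by auto
      then obtain i where i: "?G i P \<noteq> 0" using \<Omega>_zero by blast
      have "?G i P = (\<Sum>j\<in>{i1, i2}. P $ j * ?D j (?G i) 0)"
        unfolding G_linear[of P i] by (rule sum.mono_neutral_right) (auto simp: P_def axis_def)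
      also have "\<dots> = x * ?D i1 (?G i) 0 + y * ?D i2 (?G i) 0" using i12 P by simp
      also have "\<dots> = 0"
      proof (cases "i = q")
        case False
        hence "\<rho> i = p" using q \<rho>(1)[of i] pq by auto
        thus ?thesis using DG0 i12 by simp
      qed (use xy in simp)
      finally show False using i by simp
    qed
  qed
  have "?D j (?G i) x = 0" for i j x
  proof (rule ccontr)
    assume "?D j (?G i) x \<noteq> 0"
    from mono1[OF this, of UNIV] obtain \<alpha> where "c = ?M (times_var i (times_var j \<alpha>))" by auto
    from N[OF this] \<open>N = 1\<close> show False by (simp add: sum_times_var)
  qed
  hence "d_fun (?G i) x u = 0" for i x u by (simp add: d_fun_expansion[OF G UNIV_I, where v = u])
  thus ?thesis
    by (simp add: d_one_form_def d_fun_form_expansion[OF \<Omega>, of _ v] d_fun_form_expansion[OF \<Omega>, of _ u])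
qed

section \<open>Homotheties\<close>

definition herm :: "complex ^ 'n \<Rightarrow> complex ^ 'n \<Rightarrow> complex" where
  "herm x y = (\<Sum>i\<in>UNIV. x $ i * cnj (y $ i))"

lemma norm_smult_vec: "norm (s *s y) = cmod s * norm (y :: complex ^ 'n)"
  by (simp add: norm_vec_def norm_mult L2_set_right_distrib)

lemma inner_smult_vec: "x \<bullet> (s *s y) = Re (s * herm y x)"
  by (simp add: inner_vec_def herm_def inner_complex_def sum_distrib_left)
     (simp add: algebra_simps)

lemma norm_add_smult_orthogonal:
  assumes "herm a z = 0"
  shows "norm (z + s *s a) ^ 2 = norm z ^ 2 + cmod s ^ 2 * norm a ^ 2"
  using assms dot_norm[of z "s *s a"]
  by (simp add: norm_smult_vec power_mult_distrib inner_smult_vec)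

text \<open>
  Up to terms of second order in \<open>q\<close> the length of \<open>u - q w\<close> is the modulus of
  \<open>1 - q \<langle>w, u\<rangle>\<close>, which is holomorphic wherever \<open>q\<close> is. The maximum principle uses it to absorb the change of length.
\<close>

lemma norm_diff_smult_le:
  assumes "norm u = 1"
  shows "norm (u - q *s w) ^ 2 \<le> cmod (1 - q * herm w u) ^ 2 + cmod q ^ 2 * norm w ^ 2"
proof -
  have "norm (u - q *s w) ^ 2 = 1 - 2 * Re (q * herm w u) + cmod q ^ 2 * norm w ^ 2"
    using assms dot_norm_neg[of u "q *s w"]
    by (simp add: norm_smult_vec power_mult_distrib inner_smult_vec)
  moreover have "1 - 2 * Re x \<le> cmod (1 - x) ^ 2" for x
    by (simp add: cmod_power2 power2_diff)
  from this[of "q * herm w u"] calculation show ?thesis by linarith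
qed

lemma kernel_of_two_functionals:
  fixes f g :: "complex ^ 'n \<Rightarrow> complex"
  assumes "CARD('n) \<ge> 3" "Vector_Spaces.linear (*s) (*) f" "Vector_Spaces.linear (*s) (*) g"
  obtains a where "a \<noteq> 0" "f a = 0" "g a = 0"
proof -
  let ?F = "\<lambda>a. (f a, g a)"
  have scaleR: "r *\<^sub>R x = of_real r *s x" for r and x :: "complex ^ 'n"
    by (simp add: vec_eq_iff) (simp add: scaleR_conv_of_real)
  have lin: "linear ?F"
    using assms(2,3) by (auto intro!: linearI simp: Vector_Spaces.linear_iff scaleR) (simp_all add: scaleR_conv_of_real)
  have "\<not> inj ?F"
  proof
    assume "inj ?F"
    hence "dim (range ?F) = dim (UNIV :: (complex ^ 'n) set)"
      using lin by (intro dim_image_eq) (auto intro: inj_on_subset)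
    moreover have "dim (range ?F) \<le> DIM(complex \<times> complex)" by (rule dim_subset_UNIV)
    ultimately show False using assms(1) by simp
  qed
  with lin obtain a where "?F a = 0" "a \<noteq> 0" using linear_injective_0 by blast
  with that show ?thesis by (simp add: zero_prod_def)
qed

lemma small_near_critical_zero:
  assumes "(q has_field_derivative 0) (at 0)" "q 0 = 0" "\<epsilon> > 0"
  obtains d where "d > 0" "\<And>s. cmod s < d \<Longrightarrow> cmod (q s) \<le> \<epsilon> * cmod s"
proof -
  have "(q has_derivative (\<lambda>_. 0)) (at 0)"
    using assms(1) by (simp add: has_field_derivative_def lambda_zero)
  with assms(2,3) that show ?thesis
    unfolding has_derivative_at_alt by auto
qed

text \<open>
  For \<open>\<Omega>\<^sub>z(u) = 0\<close> this is the factor \<open>\<phi>(z, u)\<close> with \<open>d\<Omega>\<^sub>z(u, w) = \<phi>(z, u) \<Omega>\<^sub>z(w)\<close> for all \<open>w\<close>. The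
  weights \<open>cnj (\<Omega>\<^sub>z(e\<^sub>i))\<close> average the quotients over all \<open>w = e\<^sub>i\<close>, so that one formula is continuous
  on all of \<open>W\<close>.
\<close>

definition kernel_factor ::
    "(complex ^ 'n \<Rightarrow> complex ^ 'n \<Rightarrow> complex) \<Rightarrow> complex ^ 'n \<Rightarrow> complex ^ 'n \<Rightarrow> complex" where
  "kernel_factor \<Omega> z u =
     (\<Sum>i\<in>UNIV. d_one_form \<Omega> z u (axis i 1) * cnj (\<Omega> z (axis i 1))) /
     (\<Sum>i\<in>UNIV. \<Omega> z (axis i 1) * cnj (\<Omega> z (axis i 1)))"

lemma d_one_form_same: "d_one_form \<Omega> z v v = 0"
  by (simp add: d_one_form_def)

lemma d_one_form_swap: "d_one_form \<Omega> z u v = - d_one_form \<Omega> z v u"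
  by (simp add: d_one_form_def)

lemma linear_d_one_form:
  assumes \<Omega>: "holomorphic_one_form_on \<Omega> S" and z: "z \<in> S" "open S"
  shows "Vector_Spaces.linear (*s) (*) (\<lambda>u. d_one_form \<Omega> z u v)"
proof -
  have "Vector_Spaces.linear (*s) (*) (d_fun (\<lambda>x. \<Omega> x v) z)"
    using \<Omega> z by (auto simp: holomorphic_one_form_on_def intro: linear_d_fun)
  moreover define g where "g i = d_fun (\<lambda>x. \<Omega> x (axis i 1)) z v" for i
  have "d_fun (\<lambda>x. \<Omega> x u) z v = (\<Sum>i\<in>UNIV. u $ i * g i)" for u
    unfolding g_def by (rule d_fun_form_expansion[OF \<Omega> z])
  ultimately show ?thesis
    unfolding d_one_form_def Vector_Spaces.linear_iff
    by (simp add: algebra_simps sum.distrib sum_distrib_left)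
qed

lemma holomorphic_d_one_form:
  assumes \<Omega>: "holomorphic_one_form_on \<Omega> S" and "open S"
  shows "holomorphic_fun_on (\<lambda>z. d_one_form \<Omega> z u v) S"
proof -
  have *: "holomorphic_fun_on (\<lambda>z. d_fun (\<lambda>x. \<Omega> x v) z u) S" for u v
    using \<Omega> by (intro holomorphic_d_fun \<open>open S\<close>) (simp add: holomorphic_one_form_on_def)
  show ?thesis
  proof (rule holomorphic_funI)
    fix z assume z: "z \<in> S"
    show "((\<lambda>z. d_one_form \<Omega> z u v) has_derivative
        (\<lambda>w. d_fun (\<lambda>z. d_fun (\<lambda>x. \<Omega> x v) z u) z w - d_fun (\<lambda>z. d_fun (\<lambda>x. \<Omega> x u) z v) z w)) (at z)"
      unfolding d_one_form_def
      by (intro has_derivative_diff holomorphic_fun_has_derivative[OF * z])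
    show "Vector_Spaces.linear (*s) (*)
        (\<lambda>w. d_fun (\<lambda>z. d_fun (\<lambda>x. \<Omega> x v) z u) z w - d_fun (\<lambda>z. d_fun (\<lambda>x. \<Omega> x u) z v) z w)"
      using linear_d_fun[OF * z, of v u] linear_d_fun[OF * z, of u v]
      by (simp add: Vector_Spaces.linear_iff algebra_simps)
  qed
qed

lemma sum_mult_cnj_nonzero:
  assumes "f i \<noteq> (0::complex)"
  shows "(\<Sum>i\<in>(UNIV::'n::finite set). f i * cnj (f i)) \<noteq> 0"
proof -
  have "(\<Sum>i\<in>UNIV. f i * cnj (f i)) = of_real (\<Sum>i\<in>UNIV. cmod (f i) ^ 2)"
    by (simp flip: complex_norm_square)
  moreover have "0 < (\<Sum>i\<in>UNIV. cmod (f i) ^ 2)"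
    by (rule sum_pos2[of _ i]) (use assms in auto)
  ultimately show ?thesis by (metis less_irrefl of_real_eq_0_iff)
qed

context
  fixes \<Omega> :: "complex ^ 'n \<Rightarrow> complex ^ 'n \<Rightarrow> complex"
  assumes \<Omega>: "holomorphic_one_form_on \<Omega> UNIV"
    and nonvanishing: "nowhere_vanishing_on \<Omega> W"
    and integrable: "integrable_form_on \<Omega> W"
begin

lemma form_linear: "Vector_Spaces.linear (*s) (*) (\<Omega> z)"
  and form_holomorphic: "holomorphic_fun_on (\<lambda>z. \<Omega> z v) UNIV"
  using \<Omega> by (auto simp: holomorphic_one_form_on_def)

lemma coefficients_nonzero:
  assumes "z \<in> W"
  shows "(\<Sum>i\<in>UNIV. \<Omega> z (axis i 1) * cnj (\<Omega> z (axis i 1))) \<noteq> 0"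
proof -
  obtain v where "\<Omega> z v \<noteq> 0" using nonvanishing assms by (auto simp: nowhere_vanishing_on_def)
  then obtain i where "\<Omega> z (axis i 1) \<noteq> 0"
    using linear_vec_expansion[OF form_linear[of z], of v] by (metis (no_types, lifting) mult_zero_right sum.neutral)
  thus ?thesis by (rule sum_mult_cnj_nonzero)
qed

text \<open>
  For \<open>\<Omega>\<^sub>z(u) = 0\<close> integrability reads \<open>\<Omega>\<^sub>z(v) d\<Omega>\<^sub>z(u, w) = \<Omega>\<^sub>z(w) d\<Omega>\<^sub>z(u, v)\<close>: the two
  functionals are proportional.
\<close>

lemma contraction_on_kernel:
  assumes z: "z \<in> W" and u: "\<Omega> z u = 0"
  shows "d_one_form \<Omega> z u w = kernel_factor \<Omega> z u * \<Omega> z w"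
proof -
  have eq: "\<Omega> z v * d_one_form \<Omega> z u w = \<Omega> z w * d_one_form \<Omega> z u v" for v w
  proof -
    have "wedge_1_2 (\<Omega> z) (d_one_form \<Omega> z) u v w = 0"
      using integrable z by (auto simp: integrable_form_on_def)
    thus ?thesis using u d_one_form_swap[of \<Omega> z w u] by (simp add: wedge_1_2_def)
  qed
  have "(\<Sum>i\<in>UNIV. d_one_form \<Omega> z u (axis i 1) * cnj (\<Omega> z (axis i 1))) * \<Omega> z w
      = (\<Sum>i\<in>UNIV. \<Omega> z (axis i 1) * cnj (\<Omega> z (axis i 1))) * d_one_form \<Omega> z u w"
    unfolding sum_distrib_right
  proof (rule sum.cong)
    fix i
    show "d_one_form \<Omega> z u (axis i 1) * cnj (\<Omega> z (axis i 1)) * \<Omega> z w =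
        \<Omega> z (axis i 1) * cnj (\<Omega> z (axis i 1)) * d_one_form \<Omega> z u w"
      using eq[of "axis i 1" w] by (simp add: mult_ac)
  qed simp
  thus ?thesis
    using coefficients_nonzero[OF z] by (simp add: kernel_factor_def field_simps)
qed

lemma kernel_factor_smult: "kernel_factor \<Omega> z (k *s u) = k * kernel_factor \<Omega> z u"
  using linear_d_one_form[OF \<Omega> UNIV_I open_UNIV, of z]
  by (simp add: kernel_factor_def Vector_Spaces.linear_iff sum_distrib_left mult.assoc)

text \<open>
  Given \<open>u\<close> and a vector \<open>v\<close> with \<open>\<Omega>\<^sub>z(v) \<noteq> 0\<close>, a multiple of \<open>u\<close> differs from a kernel vector by
  a multiple of \<open>v\<close>, which \<open>d\<Omega>\<^sub>z(\<cdot>, v)\<close> does not see.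
\<close>

lemma kernel_factor_zero_imp_closed:
  assumes z: "z \<in> W" and zero: "\<And>u. \<Omega> z u = 0 \<Longrightarrow> kernel_factor \<Omega> z u = 0"
  shows "d_one_form \<Omega> z u v = 0"
proof (cases "\<Omega> z v = 0")
  case True
  hence "d_one_form \<Omega> z v u = 0" using contraction_on_kernel[OF z] zero by simp
  thus ?thesis using d_one_form_swap[of \<Omega> z u v] by simp
next
  case False
  let ?u = "\<Omega> z v *s u - \<Omega> z u *s v"
  interpret F: Vector_Spaces.linear "(*s)" "(*)" "\<Omega> z" by (rule form_linear)
  interpret T: Vector_Spaces.linear "(*s)" "(*)" "\<lambda>u. d_one_form \<Omega> z u v"
    by (rule linear_d_one_form[OF \<Omega>]) auto
  have "\<Omega> z ?u = 0" by (simp add: F.diff F.scale)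
  hence "d_one_form \<Omega> z ?u v = 0" using contraction_on_kernel[OF z] zero by simp
  hence "\<Omega> z v * d_one_form \<Omega> z u v = 0" by (simp add: T.diff T.scale d_one_form_same)
  with False show ?thesis by simp
qed

text \<open>
  At a maximum of \<open>\<bar>\<phi>(z, u)\<bar> \<bar>z\<bar> / \<bar>u\<bar>\<close> move along \<open>Z s = z0 + s a\<close>, with the kernel vector
  \<open>u0 - q(s) w0\<close>, where \<open>w0\<close> is transversal to the kernel. The direction \<open>a\<close> is chosen such that
  \<open>q(s) = o(s)\<close> and \<open>\<bar>Z s\<bar>\<^sup>2 = \<bar>z0\<bar>\<^sup>2 + \<bar>s\<bar>\<^sup>2 \<bar>a\<bar>\<^sup>2\<close>; these are two linear conditions on a vector with
  at least three coordinates. The restriction \<open>F\<close> of \<open>\<phi>\<close> to this disc, divided by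
  \<open>1 - q \<langle>w0, u0\<rangle>\<close>, is then a holomorphic function that on a small circle is strictly smaller in
  modulus than at the centre.
\<close>

lemma no_nonzero_interior_maximum:
  assumes card: "CARD('n) \<ge> 3" and z0: "z0 \<in> W" and u0: "norm u0 = 1" "\<Omega> z0 u0 = 0"
    and \<delta>: "\<delta> > 0"
    and max: "\<And>z u. norm (z - z0) < \<delta> \<Longrightarrow> norm z \<ge> norm z0 \<Longrightarrow> \<Omega> z u = 0 \<Longrightarrow>
      cmod (kernel_factor \<Omega> z u) * norm z \<le> cmod (kernel_factor \<Omega> z0 u0) * norm z0 * norm u"
  shows "kernel_factor \<Omega> z0 u0 = 0"
proof (rule ccontr)
  assume nz: "kernel_factor \<Omega> z0 u0 \<noteq> 0"
  have "Vector_Spaces.linear (*s) (*) (\<lambda>a. herm a z0)"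
    by (simp add: Vector_Spaces.linear_iff vec.vector_space_axioms vector_space_over_itself.vector_space_axioms
        herm_def algebra_simps sum.distrib sum_distrib_left)
  then obtain a where a: "a \<noteq> 0" "herm a z0 = 0" "d_fun (\<lambda>x. \<Omega> x u0) z0 a = 0"
    using kernel_of_two_functionals[OF card _ linear_d_fun[OF form_holomorphic UNIV_I]] by metis
  obtain w0 where w0: "\<Omega> z0 w0 \<noteq> 0" using nonvanishing z0 by (auto simp: nowhere_vanishing_on_def)
  define Z where "Z s = z0 + s *s a" for s
  define q where "q s = \<Omega> (Z s) u0 / \<Omega> (Z s) w0" for s
  define F where "F s = d_one_form \<Omega> (Z s) u0 w0 / \<Omega> (Z s) w0" for s
  define k where "k = herm w0 u0"
  define H where "H s = F s / (1 - q s * k)" for s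
  \<comment> \<open>Divided by \<open>\<bar>1 - q s * k\<bar>\<^sup>2\<close>, the squared length of the kernel vector is at most \<open>1 + 4 \<epsilon>\<^sup>2 \<bar>s\<bar>\<^sup>2 \<bar>w0\<bar>\<^sup>2\<close>, whose growth must stay below that of \<open>\<bar>Z s\<bar>\<^sup>2 / \<bar>z0\<bar>\<^sup>2\<close>.\<close>
  define \<epsilon> where "\<epsilon> = norm a / (2 * norm w0 * norm z0 + 1)"
  have Z0: "Z 0 = z0" by (simp add: Z_def)
  have q0: "q 0 = 0" by (simp add: q_def Z0 u0)
  have normZ: "norm (Z s) ^ 2 = norm z0 ^ 2 + cmod s ^ 2 * norm a ^ 2" for s
    unfolding Z_def by (rule norm_add_smult_orthogonal[OF a(2)])
  have \<epsilon>: "\<epsilon> > 0" "4 * \<epsilon>^2 * norm w0 ^ 2 * norm z0 ^ 2 < norm a ^ 2"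
  proof -
    have pos: "2 * norm w0 * norm z0 + 1 > 0" by (simp add: add_nonneg_pos)
    thus "\<epsilon> > 0" using a(1) by (simp add: \<epsilon>_def)
    have "\<epsilon> * (2 * norm w0 * norm z0) < \<epsilon> * (2 * norm w0 * norm z0 + 1)" using \<open>\<epsilon> > 0\<close> by simp
    also have "\<dots> = norm a" using pos by (simp add: \<epsilon>_def)
    finally have "(\<epsilon> * (2 * norm w0 * norm z0)) ^ 2 < norm a ^ 2"
      using \<open>\<epsilon> > 0\<close> by (intro power_strict_mono) auto
    thus "4 * \<epsilon>^2 * norm w0 ^ 2 * norm z0 ^ 2 < norm a ^ 2" by (simp add: power_mult_distrib algebra_simps)
  qed
  have dZ: "((\<lambda>s. \<Omega> (Z s) v) has_field_derivative d_fun (\<lambda>x. \<Omega> x v) (Z s) a) (at s)" for v s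
    unfolding Z_def by (rule has_field_derivative_along_line[OF form_holomorphic]) simp
  have "(q has_field_derivative 0) (at 0)"
  proof -
    have "(q has_field_derivative
       (d_fun (\<lambda>x. \<Omega> x u0) (Z 0) a * \<Omega> (Z 0) w0 - \<Omega> (Z 0) u0 * d_fun (\<lambda>x. \<Omega> x w0) (Z 0) a) /
          (\<Omega> (Z 0) w0 * \<Omega> (Z 0) w0)) (at 0)"
      unfolding q_def using w0 by (intro DERIV_divide dZ) (simp add: Z0)
    thus ?thesis by (simp add: Z0 a u0)
  qed
  then obtain d1 where d1: "d1 > 0" "\<And>s. cmod s < d1 \<Longrightarrow> cmod (q s) \<le> \<epsilon> * cmod s"
    using small_near_critical_zero[of q \<epsilon>] q0 \<epsilon>(1) by blast
  have "isCont (\<lambda>s. \<Omega> (Z s) w0) 0" using dZ by (rule DERIV_isCont)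
  then obtain d2 where d2: "d2 > 0" "\<And>s. cmod s < d2 \<Longrightarrow> \<Omega> (Z s) w0 \<noteq> 0"
    using continuous_at_avoid[of 0 "\<lambda>s. \<Omega> (Z s) w0" 0] w0 by (auto simp: Z0)
  \<comment> \<open>The last bound keeps \<open>1 - q s * k\<close> at distance at least one half from zero.\<close>
  define R where "R = Min {d1, d2, \<delta> / norm a, 1 / (2 * \<epsilon> * (cmod k + 1))}"
  have kpos: "2 * \<epsilon> * (cmod k + 1) > 0" using \<epsilon> by (simp add: add_nonneg_pos)
  have R: "R > 0" "R \<le> d1" "R \<le> d2" "R \<le> \<delta> / norm a" "R \<le> 1 / (2 * \<epsilon> * (cmod k + 1))"
    using d1 d2 \<delta> a kpos by (auto simp: R_def)
  have qk: "cmod (q s * k) \<le> 1/2" if "cmod s < R" for s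
  proof -
    have "cmod (q s * k) \<le> (\<epsilon> * cmod s) * (cmod k + 1)"
      unfolding norm_mult using d1(2)[of s] that R \<epsilon>(1) by (intro mult_mono) auto
    also have "\<dots> \<le> (\<epsilon> * R) * (cmod k + 1)"
      using that \<epsilon> by (intro mult_right_mono mult_left_mono) auto
    also have "\<dots> \<le> 1/2" using R(5) kpos \<epsilon>(1) by (simp add: field_simps)
    finally show ?thesis .
  qed
  have den: "cmod (1 - q s * k) \<ge> 1/2" if "cmod s < R" for s
    using qk[OF that] norm_triangle_ineq2[of 1 "q s * k"] by simp
  have F_eq: "F s = kernel_factor \<Omega> (Z s) (u0 - q s *s w0)" and U: "\<Omega> (Z s) (u0 - q s *s w0) = 0"
    if "cmod s < R" for s
  proof -
    interpret L: Vector_Spaces.linear "(*s)" "(*)" "\<Omega> (Z s)" by (rule form_linear)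
    interpret T: Vector_Spaces.linear "(*s)" "(*)" "\<lambda>u. d_one_form \<Omega> (Z s) u w0"
      by (rule linear_d_one_form[OF \<Omega>]) auto
    have nz: "\<Omega> (Z s) w0 \<noteq> 0" using d2(2)[of s] that R by simp
    show U: "\<Omega> (Z s) (u0 - q s *s w0) = 0" using nz by (simp add: L.diff L.scale q_def)
    have "Z s \<in> W" using normZ[of s] z0 by (auto simp: W_def add_nonneg_eq_0_iff)
    from contraction_on_kernel[OF this U, of w0]
    have "d_one_form \<Omega> (Z s) u0 w0 = kernel_factor \<Omega> (Z s) (u0 - q s *s w0) * \<Omega> (Z s) w0"
      by (simp add: T.diff T.scale d_one_form_same)
    thus "F s = kernel_factor \<Omega> (Z s) (u0 - q s *s w0)" using nz by (simp add: F_def)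
  qed
  have F0: "F 0 = kernel_factor \<Omega> z0 u0" using F_eq[of 0] R(1) by (simp add: q0 Z0)
  define r where "r = R / 2"
  have r: "0 < r" "r < R" using R(1) by (auto simp: r_def)
  define A where "A = norm z0 ^ 2 + r ^ 2 * norm a ^ 2"
  define B where "B = cmod (F 0) ^ 2 * (norm z0 ^ 2 + 4 * \<epsilon>^2 * r^2 * norm w0 ^ 2 * norm z0 ^ 2)"
  have bound: "cmod (H s) ^ 2 * A \<le> B" if s: "cmod s = r" for s
  proof -
    have sR: "cmod s < R" using s r by simp
    have "cmod s * norm a < R * norm a" using sR a(1) by (intro mult_strict_right_mono) auto
    also have "\<dots> \<le> \<delta>" using R(4) a(1) by (simp add: field_simps)
    finally have "norm (Z s - z0) < \<delta>" by (simp add: Z_def norm_smult_vec)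
    moreover have "norm (Z s) \<ge> norm z0"
      by (rule power2_le_imp_le) (auto simp: normZ)
    ultimately have "cmod (F s) * norm (Z s) \<le> cmod (F 0) * norm z0 * norm (u0 - q s *s w0)"
      unfolding F_eq[OF sR] F0 using max U[OF sR] by blast
    hence "(cmod (F s) * norm (Z s)) ^ 2 \<le> (cmod (F 0) * norm z0 * norm (u0 - q s *s w0)) ^ 2"
      by (rule power_mono) simp
    also have "\<dots> = cmod (F 0) ^ 2 * norm z0 ^ 2 * norm (u0 - q s *s w0) ^ 2"
      by (simp add: power_mult_distrib)
    also have "\<dots> \<le> cmod (F 0) ^ 2 * norm z0 ^ 2 * (cmod (1 - q s * k) ^ 2 + cmod (q s) ^ 2 * norm w0 ^ 2)"
      unfolding k_def by (intro mult_left_mono norm_diff_smult_le u0) auto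
    also have "\<dots> \<le> cmod (F 0) ^ 2 * norm z0 ^ 2 * (cmod (1 - q s * k) ^ 2 * (1 + 4 * \<epsilon>^2 * r^2 * norm w0 ^ 2))"
    proof (intro mult_left_mono)
      have "cmod (q s) ^ 2 * norm w0 ^ 2 \<le> (\<epsilon> * r) ^ 2 * norm w0 ^ 2"
        using d1(2)[of s] sR R s by (intro mult_right_mono power_mono) auto
      also have "\<dots> \<le> (4 * cmod (1 - q s * k) ^ 2) * ((\<epsilon> * r) ^ 2 * norm w0 ^ 2)"
      proof -
        have "(1/2)^2 \<le> cmod (1 - q s * k) ^ 2" using den[OF sR] by (intro power_mono) auto
        hence "1 \<le> 4 * cmod (1 - q s * k) ^ 2" by (simp add: power2_eq_square)
        from mult_right_mono[OF this, of "(\<epsilon> * r) ^ 2 * norm w0 ^ 2"] show ?thesis by simp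
      qed
      finally show "cmod (1 - q s * k) ^ 2 + cmod (q s) ^ 2 * norm w0 ^ 2 \<le>
          cmod (1 - q s * k) ^ 2 * (1 + 4 * \<epsilon>^2 * r^2 * norm w0 ^ 2)"
        by (simp add: algebra_simps power_mult_distrib)
    qed auto
    also have "\<dots> = B * cmod (1 - q s * k) ^ 2" by (simp add: B_def algebra_simps)
    finally have "cmod (F s) ^ 2 * A \<le> B * cmod (1 - q s * k) ^ 2"
      by (simp add: power_mult_distrib normZ A_def s)
    moreover have "0 < cmod (1 - q s * k)" using den[OF sR] by linarith
    ultimately show ?thesis by (simp add: H_def norm_divide power_divide field_simps)
  qed
  have hol: "H holomorphic_on ball 0 R"
  proof -
    have "(\<lambda>s. \<Omega> (Z s) v) holomorphic_on ball 0 R" for v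
      unfolding Z_def by (rule holomorphic_on_line[OF form_holomorphic]) simp
    moreover have "(\<lambda>s. d_one_form \<Omega> (Z s) u0 w0) holomorphic_on ball 0 R"
      unfolding Z_def by (rule holomorphic_on_line[OF holomorphic_d_one_form[OF \<Omega>]]) auto
    moreover have "\<Omega> (Z s) w0 \<noteq> 0" "1 - q s * k \<noteq> 0" if "s \<in> ball 0 R" for s
      using that d2(2)[of s] R den[of s] by auto
    ultimately show ?thesis unfolding H_def[abs_def] F_def q_def
      by (intro holomorphic_intros) auto
  qed
  have "A > 0" using z0 by (simp add: A_def W_def add_pos_nonneg)
  have "cmod (H 0) \<le> sqrt (B / A)"
  proof (rule maximum_modulus_frontier[of H "cball 0 r"])
    show "H holomorphic_on interior (cball 0 r)" "continuous_on (closure (cball 0 r)) H"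
      using r by (auto intro!: holomorphic_on_imp_continuous_on intro: holomorphic_on_subset[OF hol])
    fix s assume "s \<in> frontier (cball (0::complex) r)"
    hence "cmod s = r" using r by simp
    from bound[OF this] \<open>A > 0\<close> show "cmod (H s) \<le> sqrt (B / A)"
      by (intro real_le_rsqrt) (simp add: field_simps)
  qed (use r in auto)
  hence "cmod (H 0) ^ 2 \<le> B / A"
    using real_sqrt_le_iff[of "cmod (H 0) ^ 2"] by simp
  moreover have "H 0 = F 0" by (simp add: H_def q0)
  ultimately have "cmod (F 0) ^ 2 * A \<le> B" using \<open>A > 0\<close> by (simp add: field_simps)
  moreover have "cmod (F 0) ^ 2 > 0" using nz F0 by simp
  ultimately have "r ^ 2 * norm a ^ 2 \<le> r ^ 2 * (4 * \<epsilon>^2 * norm w0 ^ 2 * norm z0 ^ 2)"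
    unfolding A_def B_def by (simp add: mult_ac)
  with \<epsilon>(2) r show False by simp
qed

text \<open>
  Multiplication by \<open>m\<close> leaves \<open>\<bar>\<phi>(z, u)\<bar> \<bar>z\<bar>\<close> invariant, so its maximum for \<open>\<bar>u\<bar> = 1\<close> may be taken over
  a closed shell. Thus \<open>d\<Omega> = 0\<close> on the shell, and everywhere by analytic continuation along the
  complex lines through the origin.
\<close>

lemma form_closed_if_homothety_equivariant:
  assumes card: "CARD('n) \<ge> 3" and m: "0 < cmod m" "cmod m < 1"
    and equivariant: "\<And>z v. \<Omega> (m *s z) (m *s v) = c * \<Omega> z v"
  shows "d_one_form \<Omega> z u v = 0"
proof -
  have m0: "m \<noteq> 0" using m by auto
  have hom: "\<Omega> (m *s z) v = c / m * \<Omega> z v" for z v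
    using equivariant[of z v] form_linear[of "m *s z"] m0
    by (simp add: Vector_Spaces.linear_iff field_simps)
  have c0: "c \<noteq> 0"
  proof
    assume "c = 0"
    have "axis undefined 1 \<in> W" by (simp add: W_def axis_eq_0_iff)
    hence "m *s axis undefined 1 \<in> W" using m0 by (auto simp: W_def)
    then obtain v where "\<Omega> (m *s axis undefined 1) v \<noteq> 0"
      using nonvanishing by (auto simp: nowhere_vanishing_on_def)
    thus False by (simp add: hom \<open>c = 0\<close>)
  qed
  have d_hom: "d_fun (\<lambda>x. \<Omega> x v) (m *s z) u = c / m^2 * d_fun (\<lambda>x. \<Omega> x v) z u" for z u v
  proof -
    have "hopf_map (\<chi> i. m) x = m *s x" for x :: "complex ^ 'n"
      by (simp add: hopf_map_def vec_eq_iff)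
    with d_fun_hopf_map[OF form_holomorphic[of v], of "\<chi> i. m" "c / m"] hom
    have "d_fun (\<lambda>x. \<Omega> x v) (m *s z) (m *s u) = c / m * d_fun (\<lambda>x. \<Omega> x v) z u" by metis
    thus ?thesis
      using m0 by (simp add: d_fun_scale[OF form_holomorphic] field_simps power2_eq_square)
  qed
  have T_hom: "d_one_form \<Omega> (m *s z) u v = c / m^2 * d_one_form \<Omega> z u v" for z u v
    by (simp add: d_one_form_def d_hom right_diff_distrib)
  have factor_hom: "kernel_factor \<Omega> (m *s z) u = kernel_factor \<Omega> z u / m"
    if "z \<in> W" "\<Omega> z u = 0" for z u
  proof -
    obtain w where w: "\<Omega> z w \<noteq> 0" using nonvanishing \<open>z \<in> W\<close> by (auto simp: nowhere_vanishing_on_def)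
    have "m *s z \<in> W" using that m0 by (auto simp: W_def)
    from contraction_on_kernel[OF this, of u w] contraction_on_kernel[OF that, of w]
    have "c / m^2 * (kernel_factor \<Omega> z u * \<Omega> z w) = kernel_factor \<Omega> (m *s z) u * (c / m * \<Omega> z w)"
      by (simp add: T_hom hom that)
    thus ?thesis using w c0 m0 by (simp add: field_simps power2_eq_square)
  qed
  define C where "C = {p \<in> (cball 0 1 - ball 0 (cmod m)) \<times> sphere 0 1. \<Omega> (fst p) (snd p) = 0}"
  have C_iff: "(z, u) \<in> C \<longleftrightarrow> cmod m \<le> norm z \<and> norm z \<le> 1 \<and> norm u = 1 \<and> \<Omega> z u = 0" for z u
    by (auto simp: C_def)
  have contF: "continuous_on A (\<lambda>p. \<Omega> (fst p) (snd p))" for A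
  proof -
    have "continuous_on A (\<lambda>p. \<Sum>i\<in>UNIV. snd p $ i * \<Omega> (fst p) (axis i 1))"
      by (intro continuous_intros continuous_on_compose2[OF continuous_on_holomorphic_fun[OF form_holomorphic]]) auto
    thus ?thesis by (simp flip: linear_vec_expansion[OF form_linear])
  qed
  have "compact ((cball (0::complex ^ 'n) 1 - ball 0 (cmod m)) \<times> sphere (0::complex ^ 'n) 1)"
    by (intro compact_Times compact_diff) auto
  moreover have "closed C"
    unfolding C_def by (intro continuous_closed_preimage_constant contF closed_Times closed_Diff) auto
  ultimately have "compact (((cball 0 1 - ball 0 (cmod m)) \<times> sphere 0 1) \<inter> C)"
    by (rule compact_Int_closed)
  hence "compact C" by (rule back_subst[of compact]) (auto simp: C_def)
  have contT: "continuous_on A (\<lambda>p. d_one_form \<Omega> (fst p) (snd p) w)" for A w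
  proof -
    have "continuous_on A (\<lambda>p. \<Sum>i\<in>UNIV. snd p $ i * d_one_form \<Omega> (fst p) (axis i 1) w)"
      by (intro continuous_intros continuous_on_compose2[OF continuous_on_holomorphic_fun[OF holomorphic_d_one_form[OF \<Omega>]]]) auto
    thus ?thesis by (simp flip: linear_vec_expansion[OF linear_d_one_form[OF \<Omega> UNIV_I open_UNIV]])
  qed
  have in_W: "z \<in> W" if "cmod m \<le> norm z" for z using that m by (auto simp: W_def)
  have "continuous_on C (\<lambda>p. kernel_factor \<Omega> (fst p) (snd p))"
    unfolding kernel_factor_def
    by (intro continuous_intros contT
        continuous_on_compose2[OF continuous_on_holomorphic_fun[OF form_holomorphic]])
       (auto simp: C_iff dest: coefficients_nonzero[OF in_W])
  hence contPsi: "continuous_on C (\<lambda>p. cmod (kernel_factor \<Omega> (fst p) (snd p)) * norm (fst p))"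
    by (intro continuous_intros)
  have factor_zero: "kernel_factor \<Omega> z u = 0" if "(z, u) \<in> C" for z u
  proof -
    have "C \<noteq> {}" using that by auto
    from continuous_attains_sup[OF \<open>compact C\<close> this contPsi]
    obtain z1 u1 where zu1: "(z1, u1) \<in> C" and
      max1: "\<And>z u. (z, u) \<in> C \<Longrightarrow> cmod (kernel_factor \<Omega> z u) * norm z \<le> cmod (kernel_factor \<Omega> z1 u1) * norm z1"
      by force
    \<comment> \<open>A maximum on the outer sphere is moved to the inner one, so that all slightly longer vectors nearby lie in the shell.\<close>
    obtain z0 where z0: "(z0, u1) \<in> C" "norm z0 < 1" and
      Psi: "cmod (kernel_factor \<Omega> z0 u1) * norm z0 = cmod (kernel_factor \<Omega> z1 u1) * norm z1"
    proof (cases "norm z1 < 1")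
      case True
      with zu1 show ?thesis by (intro that) auto
    next
      case False
      hence "norm z1 = 1" using zu1 by (simp add: C_iff)
      with zu1 m show ?thesis
        by (intro that[of "m *s z1"]) (auto simp: C_iff norm_smult_vec hom factor_hom in_W norm_divide)
    qed
    have "kernel_factor \<Omega> z0 u1 = 0"
    proof (rule no_nonzero_interior_maximum[OF card])
      show "z0 \<in> W" "norm u1 = 1" "\<Omega> z0 u1 = 0" using z0 in_W by (auto simp: C_iff)
      show "1 - norm z0 > 0" using z0 by simp
      fix z u assume z: "norm (z - z0) < 1 - norm z0" "norm z0 \<le> norm z" "\<Omega> z u = 0"
      show "cmod (kernel_factor \<Omega> z u) * norm z \<le> cmod (kernel_factor \<Omega> z0 u1) * norm z0 * norm u"
      proof (cases "u = 0")
        case True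
        thus ?thesis using kernel_factor_smult[of z 0 u] by simp
      next
        case False
        let ?k = "of_real (inverse (norm u)) :: complex"
        have "norm z \<le> 1" using norm_triangle_ineq2[of z z0] z(1) by simp
        moreover have "cmod m \<le> norm z" using z0 z(2) by (simp add: C_iff)
        moreover have "norm (?k *s u) = 1" using False by (simp add: norm_smult_vec norm_inverse)
        moreover have "\<Omega> z (?k *s u) = 0" using z(3) form_linear[of z] by (simp add: Vector_Spaces.linear_iff)
        ultimately have "(z, ?k *s u) \<in> C" by (simp add: C_iff)
        from max1[OF this] have "inverse (norm u) * cmod (kernel_factor \<Omega> z u) * norm z \<le> cmod (kernel_factor \<Omega> z0 u1) * norm z0"
          by (simp add: Psi kernel_factor_smult norm_mult norm_inverse)
        thus ?thesis using False by (simp add: field_simps)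
      qed
    qed
    hence "cmod (kernel_factor \<Omega> z u) * norm z \<le> 0" using max1[OF that] unfolding Psi[symmetric] by simp
    moreover have "norm z > 0" using that m by (auto simp: C_iff)
    ultimately show ?thesis by (simp add: mult_le_0_iff)
  qed
  have shell: "d_one_form \<Omega> z u v = 0" if z: "cmod m \<le> norm z" "norm z \<le> 1" for z
  proof (rule kernel_factor_zero_imp_closed[OF in_W[OF z(1)]])
    fix u assume u: "\<Omega> z u = 0"
    show "kernel_factor \<Omega> z u = 0"
    proof (cases "u = 0")
      case True
      thus ?thesis using kernel_factor_smult[of z 0 u] by simp
    next
      case False
      let ?k = "of_real (inverse (norm u)) :: complex"
      have "norm (?k *s u) = 1" using False by (simp add: norm_smult_vec norm_inverse)
      moreover have "\<Omega> z (?k *s u) = 0" using u form_linear[of z] by (simp add: Vector_Spaces.linear_iff)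
      ultimately have "kernel_factor \<Omega> z (?k *s u) = 0" using z by (intro factor_zero) (simp add: C_iff)
      thus ?thesis using False by (simp add: kernel_factor_smult)
    qed
  qed
  have line: "d_one_form \<Omega> (0 + s *s y) u v = 0" if y: "norm y = 1" for y s
  proof -
    let ?S = "ball (0::complex) 1 - cball 0 (cmod m)"
    have "of_real ((1 + cmod m) / 2) \<in> ?S"
      unfolding Diff_iff mem_ball mem_cball dist_0_norm norm_of_real using m by auto
    hence ne: "?S \<noteq> {}" by blast
    have op: "open ?S" by (intro open_Diff) auto
    have hol: "(\<lambda>s. d_one_form \<Omega> (0 + s *s y) u v) holomorphic_on UNIV"
      by (rule holomorphic_on_line[OF holomorphic_d_one_form[OF \<Omega>]]) auto
    have "d_one_form \<Omega> (0 + s *s y) u v = 0" if "s \<in> ?S" for s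
      by (rule shell) (use that in \<open>auto simp: norm_smult_vec y\<close>)
    from analytic_continuation_open[OF op open_UNIV ne connected_UNIV subset_UNIV hol holomorphic_on_const this UNIV_I]
    show ?thesis .
  qed
  obtain y :: "complex ^ 'n" and s where "norm y = 1" "z = 0 + s *s y"
  proof (cases "z = 0")
    case True
    show ?thesis by (rule that[of "axis undefined 1" 0]) (use True in \<open>auto simp: norm_axis_1\<close>)
  next
    case False
    show ?thesis
      by (rule that[of "of_real (inverse (norm z)) *s z" "of_real (norm z)"])
         (use False in \<open>auto simp: norm_smult_vec norm_inverse vec_eq_iff\<close>)
  qed
  with line show ?thesis by metis
qed

end

section \<open>Sections over the Hopf manifold and their pullbacks\<close>

text \<open>
  The orbit relation only uses nonnegative powers of \<open>g\<close>. If two points have a common forward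
  image, injectivity cancels the smaller power, so that one of them lies on the forward orbit of the other.
\<close>

lemma equiv_orbit_rel:
  assumes g: "inj_on g S" "g ` S \<subseteq> S"
  shows "equiv S (orbit_rel S g)"
proof -
  have mem: "(g ^^ k) x \<in> S" if "x \<in> S" for k x
    by (induction k) (use that g in auto)
  have cancel: "x = y" if "(g ^^ k) x = (g ^^ k) y" "x \<in> S" "y \<in> S" for k x y
    using that
  proof (induction k)
    case (Suc k)
    have "(g ^^ k) x = (g ^^ k) y"
      by (rule inj_onD[OF g(1)]) (use Suc.prems mem in auto)
    with Suc show ?case by simp
  qed simp
  have trans_up: "\<exists>k. z = (g ^^ k) x \<or> x = (g ^^ k) z"
    if "y = (g ^^ i) x" "z = (g ^^ j) y" for x y z i j
    using that by (metis funpow_add o_apply)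
  have common: "\<exists>k. z = (g ^^ k) x \<or> x = (g ^^ k) z"
    if "(g ^^ i) x = (g ^^ j) z" "x \<in> S" "z \<in> S" for x z i j
  proof (cases "i \<le> j")
    case True
    then obtain d where "j = i + d" using le_Suc_ex by blast
    hence "(g ^^ i) x = (g ^^ i) ((g ^^ d) z)" using that by (simp add: funpow_add)
    hence "x = (g ^^ d) z" by (rule cancel) (use that mem in auto)
    thus ?thesis by blast
  next
    case False
    then obtain d where "i = j + d" using le_Suc_ex nat_le_linear by blast
    hence "(g ^^ j) ((g ^^ d) x) = (g ^^ j) z" using that by (simp add: funpow_add)
    hence "(g ^^ d) x = z" by (rule cancel) (use that mem in auto)
    thus ?thesis by blast
  qed
  show ?thesis
  proof (rule equivI)
    show "orbit_rel S g \<subseteq> S \<times> S" by (auto simp: orbit_rel_def)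
    show "refl_on S (orbit_rel S g)"
      by (auto simp: refl_on_def orbit_rel_def intro: exI[of _ 0])
    show "sym (orbit_rel S g)" by (auto simp: sym_def orbit_rel_def)
    show "trans (orbit_rel S g)"
    proof (rule transI)
      fix x y z assume "(x, y) \<in> orbit_rel S g" "(y, z) \<in> orbit_rel S g"
      then obtain i j where *: "x \<in> S" "y \<in> S" "z \<in> S"
        "y = (g ^^ i) x \<or> x = (g ^^ i) y" "z = (g ^^ j) y \<or> y = (g ^^ j) z"
        by (auto simp: orbit_rel_def)
      have "\<exists>k. z = (g ^^ k) x \<or> x = (g ^^ k) z"
        using *(4,5)
      proof (elim disjE)
        assume "y = (g ^^ i) x" "z = (g ^^ j) y"
        thus ?thesis by (rule trans_up)
      next
        assume "y = (g ^^ i) x" "y = (g ^^ j) z"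
        thus ?thesis using common[of i x j z] * by metis
      next
        assume "x = (g ^^ i) y" "z = (g ^^ j) y"
        hence "(g ^^ j) x = (g ^^ i) z" by (metis add.commute funpow_add o_apply)
        thus ?thesis by (rule common) (use * in auto)
      next
        assume "x = (g ^^ i) y" "y = (g ^^ j) z"
        thus ?thesis using trans_up[of y j z x i] by blast
      qed
      with * show "(x, z) \<in> orbit_rel S g" by (auto simp: orbit_rel_def)
    qed
  qed
qed

lemma orbit_rel_step:
  assumes "g ` S \<subseteq> S" "x \<in> S"
  shows "(x, g x) \<in> orbit_rel S g"
  using assms by (auto simp: orbit_rel_def intro: exI[of _ 1])

lemma orbit_class_step:
  assumes "inj_on g S" "g ` S \<subseteq> S" "x \<in> S"
  shows "orbit_rel S g `` {g x} = orbit_rel S g `` {x}"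
  using equiv_class_eq[OF equiv_orbit_rel[OF assms(1,2)] orbit_rel_step[OF assms(2,3)]] by simp

context
  fixes \<mu> :: "complex ^ 'n"
  assumes \<mu>: "\<And>i. 0 < norm (\<mu> $ i) \<and> norm (\<mu> $ i) < 1"
begin

lemma inj_hopf_map: "inj (hopf_map \<mu>)"
proof (rule injI)
  fix x y assume "hopf_map \<mu> x = hopf_map \<mu> y"
  hence "\<mu> $ i * x $ i = \<mu> $ i * y $ i" for i by (simp add: hopf_map_def vec_eq_iff)
  moreover have "\<mu> $ i \<noteq> 0" for i using \<mu>[of i] by auto
  ultimately show "x = y" by (simp add: vec_eq_iff)
qed

lemma hopf_map_W: "hopf_map \<mu> ` W \<subseteq> W"
proof -
  have "hopf_map \<mu> 0 = 0" by (simp add: hopf_map_def vec_eq_iff)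
  thus ?thesis using inj_hopf_map by (auto simp: W_def inj_def)
qed

lemma funpow_hopf_map: "(hopf_map \<mu> ^^ k) z $ i = \<mu> $ i ^ k * z $ i"
  by (induction k) (auto simp: hopf_map_def)

lemma hopf_map_acts_freely:
  assumes "z \<in> W" "(hopf_map \<mu> ^^ k) z = z"
  shows "k = 0"
proof (rule ccontr)
  assume "k \<noteq> 0"
  obtain i where i: "z $ i \<noteq> 0" using assms(1) by (auto simp: W_def vec_eq_iff)
  have "\<mu> $ i ^ k = 1" using funpow_hopf_map[of k z i] assms(2) i by simp
  hence "norm (\<mu> $ i) ^ k = 1" by (metis norm_one norm_power)
  moreover have "norm (\<mu> $ i) ^ k < 1" using \<mu>[of i] \<open>k \<noteq> 0\<close> by (simp add: power_less_one_iff)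
  ultimately show False by simp
qed

lemma funpow_map_prod:
  fixes f :: "'a \<Rightarrow> 'a" and g :: "'b \<Rightarrow> 'b"
  shows "(map_prod f g ^^ k) (x, y) = ((f ^^ k) x, (g ^^ k) y)"
  by (induction k) auto

text \<open>
  As \<open>f\<close> acts freely, two representatives over the same point differ by the zeroth power of the
  action. This is what makes the definite description in \<open>pullback\<close> well defined.
\<close>

lemma line_class_unique:
  assumes "b \<noteq> 0" and l: "l \<in> (W \<times> UNIV) // line_rel \<mu> b"
    and "(z, a) \<in> l" "(z, a') \<in> l"
  shows "a = a'"
proof -
  let ?g = "map_prod (hopf_map \<mu>) (\<lambda>v. b * v)"
  have inj: "inj_on ?g (W \<times> UNIV)"
    using inj_hopf_map \<open>b \<noteq> 0\<close> by (auto simp: inj_on_def inj_def)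
  have maps: "?g ` (W \<times> UNIV) \<subseteq> W \<times> UNIV" using hopf_map_W by auto
  have "((z, a), (z, a')) \<in> line_rel \<mu> b"
    using quotient_eq_iff[OF equiv_orbit_rel[OF inj maps] l l assms(3,4)] by simp
  then obtain k where z: "z \<in> W" and k: "(z, a') = (?g ^^ k) (z, a) \<or> (z, a) = (?g ^^ k) (z, a')"
    by (auto simp: orbit_rel_def)
  from k have "(hopf_map \<mu> ^^ k) z = z" by (auto simp: funpow_map_prod)
  from hopf_map_acts_freely[OF z this] k show ?thesis by auto
qed

text \<open>
  The points \<open>z\<close> and \<open>f z\<close> represent the same point of the quotient, and the vectors \<open>v\<close> and
  \<open>f v\<close> the same tangent vector, so \<open>\<sigma>\<close> assigns the same class to both. If \<open>(z, a)\<close> represents this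
  class, so does \<open>(f z, b a)\<close>.
\<close>

lemma pullback_equivariant:
  assumes b: "b \<noteq> 0" and \<sigma>: "holomorphic_section \<mu> b \<sigma>" and z: "z \<in> W"
  shows "pullback \<mu> b \<sigma> (hopf_map \<mu> z) (hopf_map \<mu> v) = b * pullback \<mu> b \<sigma> z v"
proof -
  let ?M = "hopf_map \<mu>"
  let ?g = "map_prod ?M (\<lambda>v. b * v)" and ?T = "map_prod ?M ?M"
  have inj: "inj_on ?M W" "inj_on ?T (W \<times> UNIV)" "inj_on ?g (W \<times> UNIV)"
    using inj_hopf_map b by (auto simp: inj_on_def inj_def)
  have maps: "?M ` W \<subseteq> W" "?T ` (W \<times> UNIV) \<subseteq> W \<times> UNIV" "?g ` (W \<times> UNIV) \<subseteq> W \<times> UNIV"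
    using hopf_map_W by auto
  define p where "p = base_rel \<mu> `` {z}"
  define t where "t = tangent_rel \<mu> `` {(z, v)}"
  have p': "base_rel \<mu> `` {?M z} = p"
    unfolding p_def by (rule orbit_class_step[OF inj(1) maps(1) z])
  have t': "tangent_rel \<mu> `` {(?M z, ?M v)} = t"
    using orbit_class_step[OF inj(2) maps(2), of "(z, v)"] z by (simp add: t_def)
  have p: "p \<in> hopf_manifold \<mu>" unfolding p_def hopf_manifold_def using z by (rule quotientI)
  have "t \<in> tangent_fibre \<mu> p"
  proof -
    have "t \<in> (W \<times> UNIV) // tangent_rel \<mu>" unfolding t_def by (rule quotientI) (use z in auto)
    moreover have "fst ` t = p"
    proof
      show "fst ` t \<subseteq> p"
        by (auto simp: t_def p_def orbit_rel_def funpow_map_prod)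
      show "p \<subseteq> fst ` t"
      proof
        fix y assume "y \<in> p"
        then obtain k where k: "y \<in> W" "y = (?M ^^ k) z \<or> z = (?M ^^ k) y"
          by (auto simp: p_def orbit_rel_def)
        from k(2) have "\<exists>w. (y, w) \<in> t"
        proof
          assume "y = (?M ^^ k) z"
          hence "(y, (?M ^^ k) v) \<in> t"
            using k z by (auto simp: t_def orbit_rel_def funpow_map_prod)
          thus ?thesis ..
        next
          assume zy: "z = (?M ^^ k) y"
          have "surj ?M"
            unfolding surj_def
          proof
            fix y show "\<exists>x. y = ?M x"
              using \<mu> by (intro exI[of _ "\<chi> i. y $ i / \<mu> $ i"]) (auto simp: hopf_map_def vec_eq_iff)
          qed
          hence "surj (?M ^^ k)" by (rule surj_fn)
          then obtain w where "v = (?M ^^ k) w" by (metis surjD)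
          hence "(y, w) \<in> t"
            using k z zy by (auto simp: t_def orbit_rel_def funpow_map_prod)
          thus ?thesis ..
        qed
        thus "y \<in> fst ` t" by force
      qed
    qed
    ultimately show ?thesis by (simp add: tangent_fibre_def)
  qed
  with \<sigma> p have l: "\<sigma> p t \<in> (W \<times> UNIV) // line_rel \<mu> b" "fst ` \<sigma> p t = p"
    by (auto simp: holomorphic_section_def line_bundle_fibre_def)
  have "z \<in> p" unfolding p_def using z by (auto simp: orbit_rel_def intro: exI[of _ 0])
  with l(2) obtain a where a: "(z, a) \<in> \<sigma> p t" by force
  have "((z, a), (?M z, b * a)) \<in> line_rel \<mu> b"
    using orbit_rel_step[OF maps(3), of "(z, a)"] z by simp
  hence a': "(?M z, b * a) \<in> \<sigma> p t"
    using in_quotient_imp_closed[OF equiv_orbit_rel[OF inj(3) maps(3)] l(1) a] by simp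
  have "pullback \<mu> b \<sigma> z v = a"
    unfolding pullback_def p_def[symmetric] t_def[symmetric]
    using a line_class_unique[OF b l(1)] by blast
  moreover have "pullback \<mu> b \<sigma> (?M z) (?M v) = b * a"
    unfolding pullback_def p' t'
    using a' line_class_unique[OF b l(1)] by blast
  ultimately show ?thesis by simp
qed

end

section \<open>Forms on the complement of the origin and first integrals\<close>

lemma one_form_extends:
  fixes \<omega> :: "complex ^ 'n \<Rightarrow> complex ^ 'n \<Rightarrow> complex"
  assumes \<omega>: "holomorphic_one_form_on \<omega> W" and card: "CARD('n) \<ge> 2"
  obtains \<Omega> where "holomorphic_one_form_on \<Omega> UNIV" "\<And>z v. z \<in> W \<Longrightarrow> \<Omega> z v = \<omega> z v"
proof -
  have lin: "Vector_Spaces.linear (*s) (*) (\<omega> z)" if "z \<in> W" for z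
    using \<omega> that by (simp add: holomorphic_one_form_on_def)
  have "\<forall>i. \<exists>G. holomorphic_fun_on G UNIV \<and> (\<forall>z\<in>W. G z = \<omega> z (axis i 1))"
  proof
    fix i
    have "holomorphic_fun_on (\<lambda>z. \<omega> z (axis i 1)) W"
      using \<omega> by (simp add: holomorphic_one_form_on_def)
    from hartogs_extension[OF this card]
    show "\<exists>G. holomorphic_fun_on G UNIV \<and> (\<forall>z\<in>W. G z = \<omega> z (axis i 1))" by metis
  qed
  then obtain G where G: "\<And>i. holomorphic_fun_on (G i) UNIV" "\<And>i z. z \<in> W \<Longrightarrow> G i z = \<omega> z (axis i 1)"
    by metis
  show ?thesis
  proof (rule that[of "\<lambda>z v. \<Sum>i\<in>UNIV. v $ i * G i z"])
    show "(\<Sum>i\<in>UNIV. v $ i * G i z) = \<omega> z v" if "z \<in> W" for z v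
      using linear_vec_expansion[OF lin[OF that], of v] G(2)[OF that] by simp
    have "holomorphic_fun_on (\<lambda>z. \<Sum>i\<in>UNIV. v $ i * G i z) UNIV" for v :: "complex ^ 'n"
    proof (rule holomorphic_funI)
      fix z
      show "((\<lambda>z. \<Sum>i\<in>UNIV. v $ i * G i z) has_derivative (\<lambda>w. \<Sum>i\<in>UNIV. v $ i * d_fun (G i) z w)) (at z)"
        by (intro has_derivative_sum has_derivative_mult_right holomorphic_fun_has_derivative[OF G(1)]) simp
      show "Vector_Spaces.linear (*s) (*) (\<lambda>w. \<Sum>i\<in>UNIV. v $ i * d_fun (G i) z w)"
        using linear_d_fun[OF G(1) UNIV_I, of _ z]
        by (simp add: Vector_Spaces.linear_iff algebra_simps sum.distrib sum_distrib_left)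
    qed
    thus "holomorphic_one_form_on (\<lambda>z v. \<Sum>i\<in>UNIV. v $ i * G i z) UNIV"
      by (simp add: holomorphic_one_form_on_def Vector_Spaces.linear_iff vec.vector_space_axioms
          vector_space_over_itself.vector_space_axioms algebra_simps sum.distrib sum_distrib_left)
  qed
qed

lemma d_one_form_cong:
  assumes "open S" "z \<in> S" "\<And>x v. x \<in> S \<Longrightarrow> \<Omega> x v = \<omega> x v"
    and "holomorphic_one_form_on \<Omega> S"
  shows "d_one_form \<Omega> z u v = d_one_form \<omega> z u v"
proof -
  have "d_fun (\<lambda>x. \<Omega> x v) z = d_fun (\<lambda>x. \<omega> x v) z" for v
  proof -
    have "((\<lambda>x. \<Omega> x v) has_derivative d_fun (\<lambda>x. \<Omega> x v) z) (at z)"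
      using assms(4,2) by (intro holomorphic_fun_has_derivative) (auto simp: holomorphic_one_form_on_def)
    hence "((\<lambda>x. \<omega> x v) has_derivative d_fun (\<lambda>x. \<Omega> x v) z) (at z)"
      using assms(1,2) by (rule has_derivative_transform_within_open) (use assms(3) in auto)
    thus ?thesis by (rule d_funI[symmetric])
  qed
  thus ?thesis by (simp add: d_one_form_def)
qed

lemma equivariance_extends_to_zero:
  fixes \<Omega> :: "complex ^ 'n \<Rightarrow> complex ^ 'n \<Rightarrow> complex"
  assumes \<Omega>: "holomorphic_one_form_on \<Omega> UNIV"
    and eq: "\<And>z v. z \<in> W \<Longrightarrow> \<Omega> (hopf_map \<mu> z) (hopf_map \<mu> v) = c * \<Omega> z v"
  shows "\<Omega> (hopf_map \<mu> z) (hopf_map \<mu> v) = c * \<Omega> z v"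
proof (cases "z = 0")
  case True
  define a :: "complex ^ 'n" where "a = axis undefined 1"
  have hol: "holomorphic_fun_on (\<lambda>x. \<Omega> x v) UNIV" for v
    using \<Omega> by (simp add: holomorphic_one_form_on_def)
  have line: "((\<lambda>s. \<Omega> (0 + s *s y) v) \<longlongrightarrow> \<Omega> 0 v) (at 0)" for y v
    using DERIV_isCont[OF has_field_derivative_along_line[where z = 0 and s = 0 and v = y, OF hol[of v] UNIV_I]]
    by (simp add: isCont_def)
  have M: "hopf_map \<mu> (s *s y) = s *s hopf_map \<mu> y" for s y
    by (simp add: hopf_map_def vec_eq_iff mult_ac)
  have "((\<lambda>s. \<Omega> (0 + s *s hopf_map \<mu> a) (hopf_map \<mu> v)) \<longlongrightarrow> c * \<Omega> 0 v) (at 0)"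
  proof (rule Lim_transform_eventually)
    show "((\<lambda>s. c * \<Omega> (0 + s *s a) v) \<longlongrightarrow> c * \<Omega> 0 v) (at 0)"
      by (intro tendsto_mult tendsto_const line)
    have "\<forall>\<^sub>F s in at 0. s \<noteq> (0::complex)" by (rule eventually_neq_at_within)
    thus "\<forall>\<^sub>F s in at 0. c * \<Omega> (0 + s *s a) v = \<Omega> (0 + s *s hopf_map \<mu> a) (hopf_map \<mu> v)"
    proof eventually_elim
      case (elim s)
      hence "s *s a \<in> W" by (auto simp: W_def a_def axis_eq_0_iff)
      from eq[OF this] show ?case by (simp add: M)
    qed
  qed
  from tendsto_unique[OF _ line this] show ?thesis
    using M[of 0 0] True by simp
qed (use eq in \<open>simp add: W_def\<close>)

theorem corollary1p9:
  fixes \<mu> :: "complex ^ ('n :: {finite, linorder})"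
    and b :: complex
    and \<sigma> :: "'n twisted_form"
  assumes "CARD('n) \<ge> 3"
    and "\<And>i. 0 < norm (\<mu> $ i) \<and> norm (\<mu> $ i) < 1"
    and "classical_hopf \<mu> \<or> intermediary_hopf \<mu> \<or> generic_hopf \<mu>"
    and "nonsingular_foliation \<mu> b \<sigma>"
  shows "\<exists>h. holomorphic_first_integral \<mu> b \<sigma> h"
proof -
  define \<omega> where "\<omega> = pullback \<mu> (inverse b) \<sigma>"
  have b: "inverse b \<noteq> 0" and sec: "holomorphic_section \<mu> (inverse b) \<sigma>"
    and \<omega>: "holomorphic_one_form_on \<omega> W" "nowhere_vanishing_on \<omega> W" "integrable_form_on \<omega> W"
    using assms(4) by (auto simp: nonsingular_foliation_def holomorphic_section_def \<omega>_def)
  have card2: "CARD('n) \<ge> 2" using assms(1) by simp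
  obtain \<Omega> where \<Omega>: "holomorphic_one_form_on \<Omega> UNIV" and ext: "\<And>z v. z \<in> W \<Longrightarrow> \<Omega> z v = \<omega> z v"
    using one_form_extends[OF \<omega>(1) card2] by metis
  have openW: "open (W :: (complex, 'n) vec set)" unfolding W_def by (intro open_Diff) auto
  have nonvanishing: "nowhere_vanishing_on \<Omega> W"
    using \<omega>(2) ext by (simp add: nowhere_vanishing_on_def)
  have "holomorphic_one_form_on \<Omega> W"
    using \<Omega> by (auto simp: holomorphic_one_form_on_def intro: holomorphic_fun_on_subset)
  hence "d_one_form \<Omega> z u v = d_one_form \<omega> z u v" if "z \<in> W" for z u v
    using openW that ext by (intro d_one_form_cong[of W]) auto
  hence integrable: "integrable_form_on \<Omega> W"
    using \<omega>(3) ext by (simp add: integrable_form_on_def wedge_1_2_def)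
  have nz: "\<mu> $ i \<noteq> 0" for i using assms(2)[of i] by auto
  have eqv: "\<Omega> (hopf_map \<mu> z) (hopf_map \<mu> v) = inverse b * \<Omega> z v" for z v
  proof (rule equivariance_extends_to_zero[OF \<Omega>])
    fix z v assume z: "z \<in> (W :: (complex, 'n) vec set)"
    hence "hopf_map \<mu> z \<in> W" using hopf_map_W[OF assms(2)] by auto
    with z show "\<Omega> (hopf_map \<mu> z) (hopf_map \<mu> v) = inverse b * \<Omega> z v"
      using pullback_equivariant[OF assms(2) b sec z] ext by (simp add: \<omega>_def)
  qed
  have closed: "d_one_form \<Omega> z u v = 0" for z u v
    using assms(3)
  proof (elim disjE)
    assume "classical_hopf \<mu>"
    define m where "m = \<mu> $ undefined"
    have m: "\<mu> $ i = m" for i using \<open>classical_hopf \<mu>\<close> unfolding classical_hopf_def m_def by blast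
    have "hopf_map \<mu> z = m *s z" for z by (simp add: hopf_map_def vec_eq_iff m)
    with eqv have "\<Omega> (m *s z) (m *s v) = inverse b * \<Omega> z v" for z v by metis
    thus ?thesis
      using assms(2)[of undefined] unfolding m_def[symmetric]
      by (intro form_closed_if_homothety_equivariant[OF \<Omega> nonvanishing integrable assms(1)]) auto
  next
    assume "generic_hopf \<mu>"
    hence "no_nontrivial_relation \<mu> UNIV" by (simp add: generic_hopf_def)
    thus ?thesis
      by (rule nonresonant_equivariant_form_closed[OF \<Omega> nonvanishing eqv nz, where \<rho> = id]) (use assms(1) in auto)
  next
    assume "intermediary_hopf \<mu>"
    then obtain k where k: "2 \<le> card {..k}" "card {..k} \<le> CARD('n) - 1"
      "\<And>i. i \<le> k \<Longrightarrow> \<mu> $ i = \<mu> $ Min UNIV"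
      and ind: "no_nontrivial_relation \<mu> (insert (Min UNIV) {k<..})"
      unfolding intermediary_hopf_def by blast
    let ?p = "Min UNIV :: 'n"
    let ?\<rho> = "\<lambda>i. if i \<le> k then ?p else i"
    have pk: "?p \<le> k" by simp
    have split: "card {..k} + card {k<..} = CARD('n)"
    proof -
      have "{..k} \<union> {k<..} = UNIV" "{..k} \<inter> {k<..} = {}" by auto
      thus ?thesis using card_Un_disjoint[of "{..k}" "{k<..}"] by auto
    qed
    have size: "card (insert ?p {k<..}) = Suc (card {k<..})"
      using pk by (subst card_insert_disjoint) auto
    show ?thesis
    proof (rule nonresonant_equivariant_form_closed[OF \<Omega> nonvanishing eqv nz ind, where \<rho> = ?\<rho>])
      show "card (insert ?p {k<..}) \<ge> 3 \<or> (\<exists>p q i1 i2. p \<noteq> q \<and> insert ?p {k<..} = {p, q} \<and>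
        i1 \<noteq> i2 \<and> ?\<rho> i1 = p \<and> ?\<rho> i2 = p \<and> (\<forall>i. ?\<rho> i = q \<longrightarrow> i = q))"
      proof (cases "card {k<..} = 1")
        case True
        then obtain q where q: "{k<..} = {q}" by (auto simp: card_1_singleton_iff)
        hence "k < q" by auto
        hence pq: "?p \<noteq> q" using pk by auto
        obtain i1 i2 where i: "i1 \<noteq> i2" "i1 \<le> k" "i2 \<le> k"
          using k(1) card_le_Suc0_iff_eq[of "{..k}"] by force
        show ?thesis
          by (rule disjI2, rule exI[of _ ?p], rule exI[of _ q], rule exI[of _ i1], rule exI[of _ i2])
             (use q pq i in auto)
      next
        case False
        with split k(2) assms(1) have "card {k<..} \<ge> 2" by linarith
        thus ?thesis using size by simp
      qed
      show "?\<rho> i \<in> insert ?p {k<..}" for i by (simp add: not_le)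
      show "?\<rho> i = i" if "i \<in> insert ?p {k<..}" for i using that pk by auto
      show "\<mu> $ ?\<rho> i = \<mu> $ i" for i using k(3)[of i] by simp
    qed
  qed
  obtain h where h: "\<And>z. (h has_derivative \<Omega> z) (at z)"
    using closed_form_exact[OF \<Omega> closed] by metis
  have dh: "d_fun h z = \<Omega> z" for z by (rule d_funI[OF h])
  have "holomorphic_fun_on h W"
    by (rule holomorphic_funI[OF h]) (use \<Omega> in \<open>simp add: holomorphic_one_form_on_def\<close>)
  moreover have "\<not> h constant_on W"
  proof
    assume "h constant_on W"
    then obtain c where c: "\<And>z. z \<in> W \<Longrightarrow> h z = c" by (auto simp: constant_on_def)
    define a :: "(complex, 'n) vec" where "a = axis undefined 1"
    have a: "a \<in> W" by (simp add: a_def W_def axis_eq_0_iff)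
    have "((\<lambda>_. c) has_derivative \<Omega> a) (at a)"
      using h openW a by (rule has_derivative_transform_within_open) (use c in auto)
    hence "\<Omega> a = (\<lambda>_. 0)" using has_derivative_const by (rule has_derivative_unique)
    with nonvanishing a show False by (auto simp: nowhere_vanishing_on_def)
  qed
  moreover have "wedge_1_1 (\<omega> z) (d_fun h z) u v = 0" if "z \<in> W" for z u v
    using ext[OF that] by (simp add: wedge_1_1_def dh)
  ultimately show ?thesis
    unfolding holomorphic_first_integral_def \<omega>_def by blast
qed

end
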